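(* (a) Let $n\ge 1$ and let $\mathcal G\subseteq\mathbb C^{n\times n}$ be the following congruence bundle: $$\mathcal G:=\begin{cases}\mathcal B^c\left(\bigoplus_{i=1}^{n/2}H_2(\mu_i)\right), & \text{if } n \text{ is even},\\ \mathcal B^c\left(\bigoplus_{i=1}^{\lfloor n/2\rfloor}H_2(\mu_i)\oplus 1\right), & \text{if } n\text{ is odd},\end{cases}$$ where, for each $i=1,\dots,\lfloor n/2\rfloor$, either $|\mu_i|>1$ or $\mu_i=e^{\mathfrak i\theta}$ for some $0<\theta<\pi$, and $\mu_i\ne\mu_{i'}$ if $i\neq i'$, for all $i,i'=1,\dots,\lfloor n/2\rfloor$. Then $\mathbb C^{n\times n}=\overline{\mathcal G}$. (b) Let $n\ge1$ and, for each $\ell=0,1,\dots,\lfloor n/2\rfloor$, let $\mathcal G_\ell\subseteq\mathbb C^{n\times n}$ be the following $^*$congruence bundle: $$\mathcal G_\ell:=\mathcal B^*\left(\bigoplus_{i=1}^{\ell}H_2(\mu_i)\oplus\bigoplus_{j=1}^{n-2\ell}\alpha_j\right),$$ where $|\mu_i|>1$ and $\mu_i\ne\mu_{i'}$ if $i\ne i'$, for all $i,i'=1,\dots,\ell$, and $|\alpha_j|=1$ and $\alpha_j^2\neq\alpha_{j'}^2$ if $j\neq j'$, for all $j,j'=1,\dots,n-2\ell$. Then: (b1) $\displaystyle\mathbb C^{n\times n}=\bigcup_{\ell=0}^{\lfloor n/2\rfloor}\overline{\mathcal G_\ell}$. (b2) $\overline{\mathcal G_{\ell_1}}\cap\mathcal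 G_{\ell_2}=\emptyset$ if $0\le\ell_1\ne\ell_2\le\lfloor n/2\rfloor$. In particular, all the closures $\overline{\mathcal G_\ell}$ in the union in (b1) are different from each other.
   Context: Closures $\overline{\mathcal W}$ are taken in the standard topology of $\mathbb C^{n\times n}$; $\mathfrak i$ is the imaginary unit; $I_k$ is the $k\times k$ identity; $\oplus$ is the block-diagonal direct sum, and a scalar denotes a $1\times1$ block. Blocks. For $k\ge1$, $\mu\in\mathbb C$: $J_k(\mu)$ is the $k\times k$ upper triangular Jordan block with eigenvalue $\mu$ (ones on the superdiagonal); $\Gamma_k$ is the $k\times k$ matrix whose entries in row $j$, columns $k-j+1$ and $k-j+2$ (the latter only if $j\ge2$) equal $(-1)^{k-j}$, for $j=1,\dots,k$, all other entries being $0$ (so $\Gamma_1=1$); $H_{2k}(\mu)=\begin{bmatrix}0&I_k\\ J_k(\mu)&0\end{bmatrix}$ is $2k\times2k$. Canonical form for congruence (CFC; known result of Horn and Sergeichuk). Every complex square matrix $A$ is congruent ($A\mapsto P^\top AP$, $P$ invertible) to a direct sum, unique up to permutation of summands, of blocks: Type 0, $J_k(0)$; Type I, $\Gamma_k$; Type II-(a), $H_{2k}(\mu)$ with $|\mu|>1$ or $\mu=e^{\mathfrak i\theta}$, $0<\theta<\pi$; Type II-(b), $H_{2k}((-1)^k)$. Canonical form for $^*$congruence ($^*$CFC; known result of Horn and Sergeichuk). Every complex square matrix is $^*$congruent ($A\mapsto P^*AP$, $P$ invertible) to a direct sum, unique up to permutation of summands, of blocks: Type 0, $J_k(0)$; Type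 I, $\alpha\Gamma_k$ with $|\alpha|=1$; Type II, $H_{2k}(\mu)$ with $|\mu|>1$. Congruence bundle. If the CFC of $A\in\mathbb C^{n\times n}$ is $\bigoplus_{j=1}^{n_1}J_{k_j}(0)\oplus\bigoplus_{j=1}^{n_2}\Gamma_{\ell_j}\oplus\bigoplus_{j=1}^{n_3}H_{2m_j}(\mu_j)\oplus\bigoplus_{j=1}^{n_4}H_{2p_j}((-1)^{p_j})$ (the third group being the Type II-(a) blocks), then $\mathcal B^c(A)$ is the set of all matrices $P\big(\bigoplus_{j=1}^{n_1}J_{k_j}(0)\oplus\bigoplus_{j=1}^{n_2}\Gamma_{\ell_j}\oplus\bigoplus_{j=1}^{n_3}H_{2m_j}(\widetilde\mu_j)\oplus\bigoplus_{j=1}^{n_4}H_{2p_j}((-1)^{p_j})\big)P^\top$ with $P\in\mathbb C^{n\times n}$ invertible, each $\widetilde\mu_j$ satisfying $|\widetilde\mu_j|>1$ or $\widetilde\mu_j=e^{\mathfrak i\widetilde\theta_j}$ with $0<\widetilde\theta_j<\pi$, and $\widetilde\mu_i\ne\widetilde\mu_j\Leftrightarrow\mu_i\neq\mu_j$ for all $i,j$. $^*$congruence bundle. If the $^*$CFC of $A\in\mathbb C^{n\times n}$ is $\bigoplus_{i=1}^{n_1}J_{k_i}(0)\oplus\bigoplus_{i=1}^{n_2}\alpha_i\Gamma_{\ell_i}\oplus\bigoplus_{i=1}^{n_3}H_{2m_i}(\mu_i)$, then $\mathcal B^*(A)$ is the set of all matrices $P\big(\bigoplus_{i=1}^{n_1}J_{k_i}(0)\oplus\bigoplus_{i=1}^{n_2}\widetilde\alpha_i\Gamma_{\ell_i}\oplus\bigoplus_{i=1}^{n_3}H_{2m_i}(\widetilde\mu_i)\big)P^*$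 with $P\in\mathbb C^{n\times n}$ invertible, $|\widetilde\alpha_i|=1$ for all $i$, $|\widetilde\mu_i|>1$ for all $i$, and, for all $i,j$: $\widetilde\alpha_i^2\ne\widetilde\alpha_j^2\Leftrightarrow\alpha_i^2\ne\alpha_j^2$ if $\ell_i\equiv\ell_j\pmod 2$; $\widetilde\alpha_i^2\ne-\widetilde\alpha_j^2\Leftrightarrow\alpha_i^2\ne-\alpha_j^2$ if $\ell_i\not\equiv\ell_j\pmod2$; and $\widetilde\mu_i\ne\widetilde\mu_j\Leftrightarrow\mu_i\ne\mu_j$. The bundles $\mathcal G$ and $\mathcal G_\ell$ do not depend on the particular values of the parameters $\mu_i,\alpha_j$ chosen subject to the stated constraints. *)

theory Defs
  imports
    "HOL-Analysis.Function_Topology"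
    "HOL-Analysis.Elementary_Metric_Spaces"
    "Jordan_Normal_Form.Jordan_Normal_Form"
    "Jordan_Normal_Form.Schur_Decomposition"
begin

section \<open>The standard topology on complex matrices of size \<open>n\<close> by \<open>n\<close>\<close>

text \<open>The type of matrices contains all sizes and carries no topology of its own. The set of
  matrices of size \<open>n\<close> by \<open>n\<close> gets the topology of the finite product of the
  copies of the complex plane indexed by the matrix positions, along the identification of a
  matrix with the family of its entries. Lemma \<open>mem_mat_closure_iff\<close> spells
  out the resulting closure.\<close>

definition entries :: "nat \<Rightarrow> complex mat \<Rightarrow> nat \<times> nat \<Rightarrow> complex" where
  "entries n A = (\<lambda>ij \<in> {..<n} \<times> {..<n}. A $$ ij)"

definition mat_topology :: "nat \<Rightarrow> complex mat topology" where
  "mat_topology n =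
     pullback_topology (carrier_mat n n) (entries n)
       (product_topology (\<lambda>_. euclidean) ({..<n} \<times> {..<n}))"

text \<open>The long name avoids the notation of the same name in HOL-Algebra.\<close>

definition mat_closure :: "nat \<Rightarrow> complex mat set \<Rightarrow> complex mat set" where
  "mat_closure n W = Abstract_Topology.closure_of (mat_topology n) W"

lemma topspace_mat_topology: "topspace (mat_topology n) = carrier_mat n n"
  by (auto simp: mat_topology_def topspace_pullback_topology entries_def)

lemma mem_mat_closure_iff:
  "A \<in> mat_closure n W \<longleftrightarrow>
     A \<in> carrier_mat n n \<and>
     (\<forall>e>0. \<exists>B \<in> W \<inter> carrier_mat n n. \<forall>i<n. \<forall>j<n. cmod (B $$ (i,j) - A $$ (i,j)) < e)"
    (is "?L \<longleftrightarrow> ?R")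
proof
  assume L: ?L
  then have A: "A \<in> carrier_mat n n"
    by (auto simp: mat_closure_def in_closure_of topspace_mat_topology)
  have "\<exists>B \<in> W \<inter> carrier_mat n n. \<forall>i<n. \<forall>j<n. cmod (B $$ (i,j) - A $$ (i,j)) < e"
    if e: "e > 0" for e :: real
  proof -
    let ?U = "PiE ({..<n} \<times> {..<n}) (\<lambda>ij. ball (A $$ ij) e)"
    have "openin (product_topology (\<lambda>_. euclidean) ({..<n} \<times> {..<n})) ?U"
      by (subst openin_PiE) auto
    then have "openin (mat_topology n) (entries n -` ?U \<inter> carrier_mat n n)"
      by (auto simp: mat_topology_def openin_pullback_topology)
    moreover have "A \<in> entries n -` ?U \<inter> carrier_mat n n"
      using A e by (auto simp: entries_def)
    ultimately have "\<exists>B. B \<in> W \<and> B \<in> entries n -` ?U \<inter> carrier_mat n n"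
      using L[unfolded mat_closure_def in_closure_of, THEN conjunct2, rule_format] by metis
    then obtain B where B: "B \<in> W" "B \<in> carrier_mat n n" and BU: "entries n B \<in> ?U"
      by auto
    have "cmod (B $$ (i, j) - A $$ (i, j)) < e" if "i < n" "j < n" for i j
    proof -
      have "entries n B (i, j) \<in> ball (A $$ (i, j)) e"
        using BU that by (intro PiE_mem[OF BU]) auto
      then show ?thesis
        using that by (simp add: entries_def dist_norm norm_minus_commute)
    qed
    with B show ?thesis by (intro bexI[of _ B]) auto
  qed
  with A show ?R by blast
next
  assume R: ?R
  show ?L
    unfolding mat_closure_def in_closure_of topspace_mat_topology
  proof (intro conjI allI impI)
    show "A \<in> carrier_mat n n" using R by blast
    fix T assume "A \<in> T \<and> openin (mat_topology n) T"
    then obtain U where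
      U: "openin (product_topology (\<lambda>_. euclidean) ({..<n} \<times> {..<n})) U"
      and T: "T = entries n -` U \<inter> carrier_mat n n" and AU: "entries n A \<in> U"
      by (auto simp: mat_topology_def openin_pullback_topology)
    obtain V where
      V': "\<forall>ij \<in> {..<n} \<times> {..<n}. openin euclidean (V ij)"
      and AV: "entries n A \<in> PiE ({..<n} \<times> {..<n}) V"
      and VU: "PiE ({..<n} \<times> {..<n}) V \<subseteq> U"
      using U[unfolded openin_product_topology_alt, rule_format, OF AU] by auto
    have V: "open (V ij)" if "ij \<in> {..<n} \<times> {..<n}" for ij
      using V' that by auto
    have "\<forall>ij \<in> {..<n} \<times> {..<n}. \<exists>e>0. ball (A $$ ij) e \<subseteq> V ij"
    proof
      fix ij assume ij: "ij \<in> {..<n} \<times> {..<n}"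
      have "entries n A ij \<in> V ij" by (rule PiE_mem[OF AV ij])
      with ij have "A $$ ij \<in> V ij" by (simp add: entries_def)
      with V[OF ij] show "\<exists>e>0. ball (A $$ ij) e \<subseteq> V ij"
        by (simp add: open_contains_ball)
    qed
    then obtain d where d: "\<And>ij. ij \<in> {..<n} \<times> {..<n} \<Longrightarrow> d ij > 0 \<and> ball (A $$ ij) (d ij) \<subseteq> V ij"
      by metis
    define e :: real where "e = Min (insert 1 (d ` ({..<n} \<times> {..<n})))"
    have e: "e > 0" unfolding e_def using d by (subst Min_gr_iff) auto
    have ed: "e \<le> d ij" if "ij \<in> {..<n} \<times> {..<n}" for ij
      unfolding e_def using that by (intro Min_le) auto
    from R e obtain B where B: "B \<in> W" "B \<in> carrier_mat n n"
      "\<forall>i<n. \<forall>j<n. cmod (B $$ (i,j) - A $$ (i,j)) < e" by blast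
    have "entries n B \<in> PiE ({..<n} \<times> {..<n}) V"
    proof (rule PiE_I)
      fix ij assume ij: "ij \<in> {..<n} \<times> {..<n}"
      then have "cmod (B $$ ij - A $$ ij) < d ij" using B(3) ed[OF ij] by (cases ij) (auto intro: less_le_trans)
      then have "B $$ ij \<in> ball (A $$ ij) (d ij)" by (simp add: dist_norm norm_minus_commute)
      then show "entries n B ij \<in> V ij" using d[OF ij] ij unfolding entries_def by (metis restrict_apply subsetD)
    qed (simp add: entries_def)
    with VU have "entries n B \<in> U" by (rule subsetD)
    with B T show "\<exists>y. y \<in> W \<and> y \<in> T" by (intro exI[of _ B]) simp
  qed
qed

section \<open>Blocks\<close>

text \<open>Rows and columns are counted from 0: with \<open>j = r + 1\<close>, the columns \<open>k - j + 1\<close> and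
  \<open>k - j + 2\<close> (counted from 1) are the columns \<open>c\<close> with \<open>r + c + 1 = k\<close> and \<open>r + c = k\<close>.
  As \<open>c < k\<close>, the latter only occurs for \<open>r \<ge> 1\<close>.\<close>

definition Gamma_block :: "nat \<Rightarrow> complex mat" where
  "Gamma_block k = mat k k (\<lambda>(r, c).
     if r + c + 1 = k \<or> r + c = k then (-1) ^ (k - Suc r) else 0)"

text \<open>The size of \<open>H_block k \<mu>\<close> is \<open>2 * k\<close>.\<close>

definition H_block :: "nat \<Rightarrow> complex \<Rightarrow> complex mat" where
  "H_block k \<mu> = four_block_mat (0\<^sub>m k k) (1\<^sub>m k) (jordan_block k \<mu>) (0\<^sub>m k k)"

definition scalar_block :: "complex \<Rightarrow> complex mat" where
  "scalar_block a = mat 1 1 (\<lambda>_. a)"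

section \<open>Congruence and its bundles\<close>

definition congruent_mat :: "complex mat \<Rightarrow> complex mat \<Rightarrow> bool" where
  "congruent_mat A B \<longleftrightarrow>
     (\<exists>P \<in> carrier_mat (dim_row A) (dim_row A). invertible_mat P \<and> B = transpose_mat P * A * P)"

definition typeIIa :: "complex \<Rightarrow> bool" where
  "typeIIa \<mu> \<longleftrightarrow> cmod \<mu> > 1 \<or> (\<exists>\<theta>. 0 < \<theta> \<and> \<theta> < pi \<and> \<mu> = exp (\<i> * of_real \<theta>))"

text \<open>\<open>ks\<close>, \<open>ls\<close>, \<open>ps\<close> list the indices of the blocks of Types 0, I and II-(b), while the
  \<open>j\<close>-th block of Type II-(a) has index \<open>ms ! j\<close> and parameter \<open>\<mu>s ! j\<close>.\<close>

definition CFC_mat ::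
  "nat list \<Rightarrow> nat list \<Rightarrow> nat list \<Rightarrow> complex list \<Rightarrow> nat list \<Rightarrow> complex mat" where
  "CFC_mat ks ls ms \<mu>s ps = diag_block_mat
     (map (\<lambda>k. jordan_block k 0) ks @ map Gamma_block ls @ map2 H_block ms \<mu>s
      @ map (\<lambda>p. H_block p ((-1) ^ p)) ps)"

definition is_CFC ::
  "complex mat \<Rightarrow> nat list \<Rightarrow> nat list \<Rightarrow> nat list \<Rightarrow> complex list \<Rightarrow> nat list \<Rightarrow> bool" where
  "is_CFC A ks ls ms \<mu>s ps \<longleftrightarrow>
     (\<forall>k \<in> set (ks @ ls @ ms @ ps). k \<ge> 1) \<and> length \<mu>s = length ms \<and>
     (\<forall>\<mu> \<in> set \<mu>s. typeIIa \<mu>) \<and> congruent_mat A (CFC_mat ks ls ms \<mu>s ps)"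

text \<open>The canonical form of \<open>A\<close> is unique only up to the order of its summands. The set below
  runs over all orders (within each type), which does not change it, since a permutation of
  summands is a congruence.\<close>

definition congruence_bundle :: "complex mat \<Rightarrow> complex mat set" where
  "congruence_bundle A =
     {P * CFC_mat ks ls ms \<mu>s' ps * transpose_mat P | P ks ls ms \<mu>s \<mu>s' ps.
        is_CFC A ks ls ms \<mu>s ps \<and>
        P \<in> carrier_mat (dim_row A) (dim_row A) \<and> invertible_mat P \<and>
        length \<mu>s' = length \<mu>s \<and> (\<forall>\<mu> \<in> set \<mu>s'. typeIIa \<mu>) \<and>
        (\<forall>i < length \<mu>s. \<forall>j < length \<mu>s. \<mu>s' ! i \<noteq> \<mu>s' ! j \<longleftrightarrow> \<mu>s ! i \<noteq> \<mu>s ! j)}"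

section \<open>*congruence and its bundles\<close>

definition star_congruent_mat :: "complex mat \<Rightarrow> complex mat \<Rightarrow> bool" where
  "star_congruent_mat A B \<longleftrightarrow>
     (\<exists>P \<in> carrier_mat (dim_row A) (dim_row A). invertible_mat P \<and> B = mat_adjoint P * A * P)"

definition star_CFC_mat ::
  "nat list \<Rightarrow> nat list \<Rightarrow> complex list \<Rightarrow> nat list \<Rightarrow> complex list \<Rightarrow> complex mat" where
  "star_CFC_mat ks ls \<alpha>s ms \<mu>s = diag_block_mat
     (map (\<lambda>k. jordan_block k 0) ks @ map2 (\<lambda>l \<alpha>. \<alpha> \<cdot>\<^sub>m Gamma_block l) ls \<alpha>s @ map2 H_block ms \<mu>s)"

definition is_star_CFC ::
  "complex mat \<Rightarrow> nat list \<Rightarrow> nat list \<Rightarrow> complex list \<Rightarrow> nat list \<Rightarrow> complex list \<Rightarrow> bool" where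
  "is_star_CFC A ks ls \<alpha>s ms \<mu>s \<longleftrightarrow>
     (\<forall>k \<in> set (ks @ ls @ ms). k \<ge> 1) \<and> length \<alpha>s = length ls \<and> length \<mu>s = length ms \<and>
     (\<forall>\<alpha> \<in> set \<alpha>s. cmod \<alpha> = 1) \<and> (\<forall>\<mu> \<in> set \<mu>s. cmod \<mu> > 1) \<and>
     star_congruent_mat A (star_CFC_mat ks ls \<alpha>s ms \<mu>s)"

definition star_congruence_bundle :: "complex mat \<Rightarrow> complex mat set" where
  "star_congruence_bundle A =
     {P * star_CFC_mat ks ls \<alpha>s' ms \<mu>s' * mat_adjoint P | P ks ls \<alpha>s \<alpha>s' ms \<mu>s \<mu>s'.
        is_star_CFC A ks ls \<alpha>s ms \<mu>s \<and>
        P \<in> carrier_mat (dim_row A) (dim_row A) \<and> invertible_mat P \<and>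
        length \<alpha>s' = length \<alpha>s \<and> (\<forall>\<alpha> \<in> set \<alpha>s'. cmod \<alpha> = 1) \<and>
        length \<mu>s' = length \<mu>s \<and> (\<forall>\<mu> \<in> set \<mu>s'. cmod \<mu> > 1) \<and>
        (\<forall>i < length ls. \<forall>j < length ls.
           (ls ! i mod 2 = ls ! j mod 2 \<longrightarrow>
              ((\<alpha>s' ! i)\<^sup>2 \<noteq> (\<alpha>s' ! j)\<^sup>2 \<longleftrightarrow> (\<alpha>s ! i)\<^sup>2 \<noteq> (\<alpha>s ! j)\<^sup>2)) \<and>
           (ls ! i mod 2 \<noteq> ls ! j mod 2 \<longrightarrow>
              ((\<alpha>s' ! i)\<^sup>2 \<noteq> - (\<alpha>s' ! j)\<^sup>2 \<longleftrightarrow> (\<alpha>s ! i)\<^sup>2 \<noteq> - (\<alpha>s ! j)\<^sup>2))) \<and>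
        (\<forall>i < length \<mu>s. \<forall>j < length \<mu>s. \<mu>s' ! i \<noteq> \<mu>s' ! j \<longleftrightarrow> \<mu>s ! i \<noteq> \<mu>s ! j)}"

section \<open>The generic bundles\<close>

definition generic_congruence_bundle :: "nat \<Rightarrow> (nat \<Rightarrow> complex) \<Rightarrow> complex mat set" where
  "generic_congruence_bundle n \<mu> = congruence_bundle (diag_block_mat
     (map (\<lambda>i. H_block 1 (\<mu> i)) [1..<n div 2 + 1] @ (if even n then [] else [scalar_block 1])))"

definition generic_star_congruence_bundle ::
  "nat \<Rightarrow> nat \<Rightarrow> (nat \<Rightarrow> complex) \<Rightarrow> (nat \<Rightarrow> complex) \<Rightarrow> complex mat set" where
  "generic_star_congruence_bundle n l \<mu> \<alpha> = star_congruence_bundle (diag_block_mat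
     (map (\<lambda>i. H_block 1 (\<mu> i)) [1..<l + 1] @
      map (\<lambda>j. scalar_block (\<alpha> j)) [1..<n - 2 * l + 1]))"

end

(*
  For tau = id or tau = complex conjugation write adj A = transpose (tau A). The pencil
  A - z adj A has, up to a nonzero constant, the same determinant for all A in a congruence or *congruence
  class, and its root set is closed under w |-> 1 / tau w. If A is invertible and the pencil has n
  distinct roots, the values adj u * A * v on two eigenvectors for roots w, w' vanish unless
  w' = 1 / tau w, so an eigenbasis reduces A to blocks of size 1 (roots fixed by the involution) and
  H_2(w) (pairs of roots). Such matrices are dense, because along a line through one of them the
  resultant of the pencil determinant and its derivative is a nonzero polynomial. Hence G_l consists
  of the invertible A with n distinct roots, exactly n - 2 l of them on the unit circle. Roots
  depend continuously on A, and a simple root on the unit circle cannot leave it under a small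
  perturbation, since its reflection 1 / cnj w would be a second root nearby; this separates the G_l.
*)
theory Submission
  imports Defs "Subresultants.Subresultant_Gcd" "HOL-Computational_Algebra.Field_as_Ring"
begin

section \<open>The pencil of a matrix\<close>

text \<open>Under conjugation the entries of the pencil are not polynomial in the entries of
  \<open>A\<close>, but along a line with a real parameter \<open>t\<close> they are affine in
  \<open>t\<close>. This is why density is proved on real lines through one matrix with simple
  roots. For tau = id a block of size 1 always has the root 1, so simple roots leave room for at
  most one such block; the parity of \<open>n\<close> then fixes the shape and a single bundle is
  dense. For conjugation a unimodular \<open>c\<close> has the root \<open>c\<^sup>2\<close>, which
  may lie anywhere on the unit circle, so the number of blocks of size 1 varies and gives the index
  l. A bundle runs over all canonical forms of its representative. Hence the description of G_l also
  requires that no canonical form of a matrix with simple nonzero roots contains a larger block;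
  this follows from counting the roots that each block can contribute. Continuity of the roots is
  made explicit by the identity: the modulus of \<open>det (pencil A w)\<close> is the modulus of
  \<open>det A\<close> times the product of the distances from \<open>w\<close> to the
  roots.\<close>

text \<open>The two instances used are the identity, for congruence, and complex conjugation, for
  *congruence.\<close>

locale involution =
  fixes tau :: "complex \<Rightarrow> complex"
  assumes tau_add [simp]: "tau (x + y) = tau x + tau y"
    and tau_mult [simp]: "tau (x * y) = tau x * tau y"
    and tau_tau [simp]: "tau (tau x) = x"
    and tau_of_real [simp]: "tau (of_real r) = of_real r"
begin

lemma tau_0 [simp]: "tau 0 = 0" and tau_1 [simp]: "tau 1 = 1"
  using tau_of_real[of 0] tau_of_real[of 1] by simp_all

sublocale comm_ring_hom tau
  by unfold_locales simp_all

lemma tau_eq_0_iff [simp]: "tau x = 0 \<longleftrightarrow> x = 0"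
  by (metis tau_0 tau_tau)

lemma tau_inverse: "tau (inverse x) = inverse (tau x)"
proof (cases "x = 0")
  case False
  then have "tau x * tau (inverse x) = 1"
    by (simp flip: tau_mult)
  then show ?thesis by (simp add: inverse_unique)
qed simp

definition adj :: "complex mat \<Rightarrow> complex mat" where
  "adj A = transpose_mat (map_mat tau A)"

lemma dim_adj [simp]: "dim_row (adj A) = dim_col A" "dim_col (adj A) = dim_row A"
  by (simp_all add: adj_def)

lemma adj_carrier [simp]: "A \<in> carrier_mat m n \<Longrightarrow> adj A \<in> carrier_mat n m"
  by (simp add: adj_def)

lemma index_adj [simp]: "i < dim_col A \<Longrightarrow> j < dim_row A \<Longrightarrow> adj A $$ (i, j) = tau (A $$ (j, i))"
  by (simp add: adj_def)

lemma adj_adj [simp]: "adj (adj A) = A"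
  by (rule eq_matI) simp_all

lemma adj_mult: "A \<in> carrier_mat m k \<Longrightarrow> B \<in> carrier_mat k n \<Longrightarrow> adj (A * B) = adj B * adj A"
  unfolding adj_def by (simp add: mat_hom_mult transpose_mult)

lemma det_adj: "A \<in> carrier_mat n n \<Longrightarrow> det (adj A) = tau (det A)"
  unfolding adj_def by (subst det_transpose) auto

lemma adj_one: "adj (1\<^sub>m n) = 1\<^sub>m n"
  by (rule eq_matI) auto

definition pencil :: "complex mat \<Rightarrow> complex \<Rightarrow> complex mat" where
  "pencil A z = A - z \<cdot>\<^sub>m adj A"

definition pencil_roots :: "complex mat \<Rightarrow> complex set" where
  "pencil_roots A = {z. det (pencil A z) = 0}"

lemma pencil_carrier [simp]: "A \<in> carrier_mat n n \<Longrightarrow> pencil A z \<in> carrier_mat n n"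
  by (auto simp: pencil_def intro!: minus_carrier_mat)

lemma pencil_cong:
  assumes A: "A \<in> carrier_mat n n" and P: "P \<in> carrier_mat n n"
  shows "pencil (adj P * A * P) z = adj P * pencil A z * P"
proof -
  note c = A P adj_carrier[OF P] adj_carrier[OF A]
  have "adj (adj P * A * P) = adj P * (adj A * P)"
    unfolding adj_mult[OF mult_carrier_mat[OF c(3,1)] c(2)] adj_mult[OF c(3,1)] adj_adj ..
  also have "\<dots> = adj P * adj A * P"
    by (rule assoc_mult_mat[OF c(3,4,2), symmetric])
  finally have e: "z \<cdot>\<^sub>m adj (adj P * A * P) = adj P * (z \<cdot>\<^sub>m adj A) * P"
    by (simp only: mult_smult_distrib[OF c(3,4)] mult_smult_assoc_mat[OF mult_carrier_mat[OF c(3,4)] c(2)])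
  have "adj P * pencil A z * P = (adj P * A - adj P * (z \<cdot>\<^sub>m adj A)) * P"
    unfolding pencil_def by (subst mult_minus_distrib_mat[OF c(3,1)]) (use c in auto)
  also have "\<dots> = adj P * A * P - adj P * (z \<cdot>\<^sub>m adj A) * P"
    by (rule minus_mult_distrib_mat[OF mult_carrier_mat[OF c(3,1)] mult_carrier_mat[OF c(3) smult_carrier_mat[OF c(4)]] c(2)])
  finally show ?thesis by (simp only: e pencil_def[of "adj P * A * P"])
qed

lemma det_pencil_cong:
  assumes A: "A \<in> carrier_mat n n" and P: "P \<in> carrier_mat n n"
  shows "det (pencil (adj P * A * P) z) = tau (det P) * det P * det (pencil A z)"
proof -
  have "det (adj P * pencil A z * P) = det (adj P * pencil A z) * det P"
    by (rule det_mult[OF mult_carrier_mat[OF adj_carrier[OF P] pencil_carrier[OF A]] P])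
  also have "det (adj P * pencil A z) = det (adj P) * det (pencil A z)"
    by (rule det_mult[OF adj_carrier[OF P] pencil_carrier[OF A]])
  finally show ?thesis
    unfolding pencil_cong[OF assms] det_adj[OF P] by (simp add: mult_ac)
qed

lemma pencil_roots_cong:
  assumes A: "A \<in> carrier_mat n n" and P: "P \<in> carrier_mat n n" and "det P \<noteq> 0"
  shows "pencil_roots (adj P * A * P) = pencil_roots A"
  using assms by (simp add: pencil_roots_def det_pencil_cong)

lemma pencil_0: "A \<in> carrier_mat n n \<Longrightarrow> pencil A 0 = A"
  by (auto simp: pencil_def)

lemma pencil_roots_nonzero:
  "A \<in> carrier_mat n n \<Longrightarrow> det A \<noteq> 0 \<Longrightarrow> z \<in> pencil_roots A \<Longrightarrow> z \<noteq> 0"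
  by (auto simp: pencil_roots_def pencil_0)

text \<open>Applying \<open>adj\<close> to the pencil at \<open>z\<close> exchanges \<open>A\<close>
  and \<open>adj A\<close>, which up to the factor \<open>- tau z\<close> is the pencil at the
  reflected point; and \<open>adj\<close> preserves the vanishing of the determinant.\<close>

lemma pencil_roots_reciprocal:
  assumes A: "A \<in> carrier_mat n n" and d: "det A \<noteq> 0" and z: "z \<in> pencil_roots A"
  shows "inverse (tau z) \<in> pencil_roots A"
proof -
  have z0: "z \<noteq> 0" using pencil_roots_nonzero[OF assms] .
  have "pencil A (inverse (tau z)) = (- inverse (tau z)) \<cdot>\<^sub>m adj (pencil A z)"
    using A z0 by (intro eq_matI) (auto simp: pencil_def hom_minus field_simps)
  then show ?thesis using z det_adj[OF pencil_carrier[OF A], of z] by (simp add: pencil_roots_def)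
qed

text \<open>A determinant over the polynomial ring, so that degree, leading coefficient and
  square-freeness become available for the function that sends \<open>z\<close> to
  \<open>det (pencil A z)\<close>.\<close>

definition pencil_poly :: "complex mat \<Rightarrow> complex poly" where
  "pencil_poly A = det (mat (dim_row A) (dim_row A) (\<lambda>(i, j). [:A $$ (i, j), - adj A $$ (i, j):]))"

lemma poly_pencil_poly:
  assumes "A \<in> carrier_mat n n"
  shows "poly (pencil_poly A) z = det (pencil A z)"
  unfolding pencil_poly_def
  by (rule poly_det_cong[of _ n]) (use assms in \<open>auto simp: pencil_def\<close>)

lemma degree_pencil_poly_le:
  assumes "A \<in> carrier_mat n n"
  shows "degree (pencil_poly A) \<le> n"
  using degree_det_le[of n "mat n n (\<lambda>(i, j). [:A $$ (i, j), - adj A $$ (i, j):])" 1] assms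
  by (simp add: pencil_poly_def)

lemma pencil_poly_nonzero:
  assumes "A \<in> carrier_mat n n" "det A \<noteq> 0"
  shows "pencil_poly A \<noteq> 0"
  using poly_pencil_poly[OF assms(1), of 0] assms by (auto simp: pencil_0)

lemma finite_pencil_roots:
  assumes "A \<in> carrier_mat n n" "det A \<noteq> 0"
  shows "finite (pencil_roots A)"
  using poly_roots_finite[OF pencil_poly_nonzero[OF assms]] assms
  by (simp add: pencil_roots_def poly_pencil_poly)

lemma pencil_four_block_diag:
  assumes "A \<in> carrier_mat n n" "B \<in> carrier_mat m m"
  shows "pencil (four_block_mat A (0\<^sub>m n m) (0\<^sub>m m n) B) z
    = four_block_mat (pencil A z) (0\<^sub>m n m) (0\<^sub>m m n) (pencil B z)"
  using assms by (intro eq_matI) (auto simp: pencil_def)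

lemma det_pencil_diag_block:
  assumes "\<forall>B \<in> set Bs. square_mat B"
  shows "det (pencil (diag_block_mat Bs) z) = (\<Prod>B\<leftarrow>Bs. det (pencil B z))"
  using assms
proof (induction Bs)
  case Nil
  have "pencil (0\<^sub>m 0 0) z \<in> carrier_mat 0 0" by (rule pencil_carrier) simp
  then show ?case by simp
next
  case (Cons B Bs)
  define D where "D = diag_block_mat Bs"
  have D: "D \<in> carrier_mat (dim_row D) (dim_row D)"
    using diag_block_mat_square[of Bs] Cons.prems unfolding D_def[symmetric] by auto
  have B: "B \<in> carrier_mat (dim_row B) (dim_row B)"
    using Cons.prems by auto
  have c: "dim_col D = dim_row D" "dim_col B = dim_row B"
    by (rule carrier_matD(2)[OF D], rule carrier_matD(2)[OF B])
  have "det (pencil (diag_block_mat (B # Bs)) z) = det (pencil B z) * det (pencil D z)"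
    unfolding diag_block_mat.simps Let_def D_def[symmetric] c pencil_four_block_diag[OF B D]
    by (rule det_four_block_mat_upper_right_zero[OF pencil_carrier[OF B] refl _ pencil_carrier[OF D]]) simp
  then show ?case using Cons by (simp add: D_def)
qed

end

section \<open>Density of matrices whose pencil has simple roots\<close>

text \<open>Over the complex numbers a gcd of positive degree has a root, and a common root of
  \<open>p\<close> and \<open>pderiv p\<close> is a multiple root of \<open>p\<close>.\<close>

lemma resultant_pderiv_nonzero_iff_rsquarefree:
  fixes p :: "complex poly"
  assumes "p \<noteq> 0"
  shows "resultant p (pderiv p) \<noteq> 0 \<longleftrightarrow> rsquarefree p"
proof -
  have g0: "gcd p (pderiv p) \<noteq> 0" using assms by simp
  have "degree (gcd p (pderiv p)) \<noteq> 0 \<longleftrightarrow> (\<exists>a. poly (gcd p (pderiv p)) a = 0)"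
  proof
    assume "degree (gcd p (pderiv p)) \<noteq> 0"
    then have "\<not> constant (poly (gcd p (pderiv p)))" by (simp add: constant_degree)
    then show "\<exists>a. poly (gcd p (pderiv p)) a = 0" by (rule fundamental_theorem_of_algebra)
  next
    assume "\<exists>a. poly (gcd p (pderiv p)) a = 0"
    then show "degree (gcd p (pderiv p)) \<noteq> 0"
      using g0 by (metis degree_eq_zeroE poly_const_conv pCons_0_0)
  qed
  also have "\<dots> \<longleftrightarrow> (\<exists>a. poly p a = 0 \<and> poly (pderiv p) a = 0)"
    by (simp add: poly_eq_0_iff_dvd)
  finally show ?thesis by (auto simp: resultant_0_gcd rsquarefree_roots)
qed

context involution begin

definition generic :: "nat \<Rightarrow> complex mat \<Rightarrow> bool" where
  "generic n A \<longleftrightarrow> A \<in> carrier_mat n n \<and> det A \<noteq> 0 \<and> card (pencil_roots A) = n"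

text \<open>As the degree is at most \<open>n\<close>, having \<open>n\<close> distinct roots means
  full degree and no multiple root. In this form genericity is the nonvanishing of the constant
  coefficient, of the coefficient of degree \<open>n\<close> and of a resultant.\<close>

lemma generic_iff_pencil_poly:
  assumes A: "A \<in> carrier_mat n n"
  shows "generic n A \<longleftrightarrow> poly (pencil_poly A) 0 \<noteq> 0 \<and> degree (pencil_poly A) = n \<and>
    rsquarefree (pencil_poly A)"
proof (cases "det A = 0")
  case True
  then show ?thesis using A by (simp add: generic_def poly_pencil_poly pencil_0)
next
  case False
  have p0: "pencil_poly A \<noteq> 0" by (rule pencil_poly_nonzero[OF A False])
  have r: "pencil_roots A = {z. poly (pencil_poly A) z = 0}"
    using A by (simp add: pencil_roots_def poly_pencil_poly)
  have "card (pencil_roots A) \<le> degree (pencil_poly A)"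
    unfolding r by (rule poly_roots_degree[OF p0])
  then have "card (pencil_roots A) = n \<longleftrightarrow>
      degree (pencil_poly A) = n \<and> card (pencil_roots A) = degree (pencil_poly A)"
    using degree_pencil_poly_le[OF A] by auto
  then show ?thesis
    using A False rsquarefree_card_degree[OF p0] r by (auto simp: generic_def poly_pencil_poly pencil_0)
qed

text \<open>For positive \<open>n\<close>, a product of three polynomials in \<open>t\<close>
  detects genericity along the line. It is not the zero polynomial, since at \<open>t = 1\<close>
  the line passes through \<open>B\<close>.\<close>

lemma generic_on_line:
  assumes A: "A \<in> carrier_mat n n" and B: "generic n B"
  shows "finite {t :: real. \<not> generic n (A + of_real t \<cdot>\<^sub>m (B - A))}"
proof -
  have Bc: "B \<in> carrier_mat n n" using B by (simp add: generic_def)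
  \<comment> \<open>The outer polynomial variable is that of the pencil, the inner one is
    \<open>t\<close>. As \<open>t\<close> is real, \<open>tau\<close> fixes it and the entries of
    the adjoint stay affine in \<open>t\<close>.\<close>
  define M where "M = mat n n (\<lambda>(i, j). [: [:A $$ (i, j), B $$ (i, j) - A $$ (i, j):],
    - [:adj A $$ (i, j), adj B $$ (i, j) - adj A $$ (i, j):] :])"
  define P where "P = det M"
  define L where "L t = A + of_real t \<cdot>\<^sub>m (B - A)" for t :: real
  have Lc: "L t \<in> carrier_mat n n" for t
    unfolding L_def using A Bc by auto
  have degP: "degree P \<le> n"
    using degree_det_le[of n M 1] by (simp add: P_def M_def)
  define ev where "ev t = map_poly (\<lambda>c :: complex poly. poly c (complex_of_real t))" for t
  have evP: "ev t P = pencil_poly (L t)" for t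
  proof -
    interpret h: map_poly_comm_ring_hom "\<lambda>c :: complex poly. poly c (complex_of_real t)" ..
    have "map_mat (ev t) M =
        mat (dim_row (L t)) (dim_row (L t)) (\<lambda>(i, j). [:L t $$ (i, j), - adj (L t) $$ (i, j):])"
      using A Bc unfolding M_def ev_def L_def
      by (intro eq_matI) (auto simp: hom_minus poly_hom.map_poly_pCons_hom algebra_simps)
    then have "det (map_mat (ev t) M) = pencil_poly (L t)"
      by (simp add: pencil_poly_def)
    then show ?thesis by (simp add: P_def ev_def)
  qed
  have ev_pderiv: "ev t (pderiv p) = pderiv (ev t p)" for t p
    unfolding ev_def by (rule poly_hom.map_poly_pderiv)
  define c where "c = coeff P n"
  define q where "q = resultant P (pderiv P)"
  define d where "d = poly P 0"
  have degev: "degree (ev t P) = n \<longleftrightarrow> poly c (of_real t) \<noteq> 0" if "n > 0" for t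
  proof
    assume "degree (ev t P) = n"
    then have "coeff (ev t P) n \<noteq> 0" using that
      by (metis leading_coeff_0_iff degree_0 less_numeral_extra(3))
    then show "poly c (of_real t) \<noteq> 0" by (simp add: ev_def c_def coeff_map_poly)
  next
    assume "poly c (of_real t) \<noteq> 0"
    then have "coeff (ev t P) n \<noteq> 0" by (simp add: ev_def c_def coeff_map_poly)
    then have "n \<le> degree (ev t P)" by (rule le_degree)
    moreover have "degree (ev t P) \<le> n"
      unfolding evP by (rule degree_pencil_poly_le[OF Lc])
    ultimately show "degree (ev t P) = n" by simp
  qed
  have ev0: "poly (ev t P) 0 = poly d (of_real t)" for t
    by (simp add: ev_def d_def poly_0_coeff_0 coeff_map_poly)
  \<comment> \<open>Evaluating the coefficients commutes with the resultant when no degree drops,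
    which the condition on the coefficient \<open>c\<close> of degree \<open>n\<close>
    guarantees.\<close>
  have res: "poly q (of_real t) = resultant (ev t P) (pderiv (ev t P))"
    if "poly c (of_real t) \<noteq> 0" "n > 0" for t
  proof -
    have "coeff P n \<noteq> 0" using that by (auto simp: c_def)
    then have "degree P = n" using degP le_degree[of P n] by simp
    then have d: "degree (ev t P) = degree P" using degev that by simp
    then have "degree (ev t (pderiv P)) = degree (pderiv P)"
      by (simp add: ev_pderiv degree_pderiv)
    then show ?thesis using d unfolding q_def ev_pderiv[symmetric]
      by (simp add: ev_def poly_hom.resultant_map_poly)
  qed
  have gen: "generic n (L t) \<longleftrightarrow> poly (c * q * d) (of_real t) \<noteq> 0" if "n > 0" for t
  proof (cases "poly c (of_real t) = 0")
    case True
    then show ?thesis using degev[OF that, of t] by (simp add: generic_iff_pencil_poly[OF Lc] evP)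
  next
    case False
    have "ev t P \<noteq> 0" using degev[OF that, of t] False that by auto
    then have "poly q (of_real t) \<noteq> 0 \<longleftrightarrow> rsquarefree (ev t P)"
      unfolding res[OF False that] by (rule resultant_pderiv_nonzero_iff_rsquarefree)
    then show ?thesis using False degev[OF that, of t] ev0[of t]
      by (auto simp: generic_iff_pencil_poly[OF Lc] evP)
  qed
  show ?thesis
  proof (cases "n = 0")
    case True
    have "generic n X" if "X \<in> carrier_mat n n" for X
      using that True by (auto simp: generic_def pencil_roots_def)
    then show ?thesis using Lc by (simp add: L_def)
  next
    case False
    have "L 1 = B" using A Bc by (auto simp: L_def)
    then have "poly (c * q * d) (of_real 1) \<noteq> 0" using gen[of 1] B False by simp
    then have "c * q * d \<noteq> 0" by auto
    then have "finite {z. poly (c * q * d) z = 0}" by (rule poly_roots_finite)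
    then have "finite (of_real -` {z. poly (c * q * d) z = 0} :: real set)"
      by (rule finite_vimageI) (simp add: inj_on_def)
    moreover have "{t :: real. \<not> generic n (A + of_real t \<cdot>\<^sub>m (B - A))}
        = of_real -` {z. poly (c * q * d) z = 0}"
      using gen False by (auto simp: L_def)
    ultimately show ?thesis by simp
  qed
qed

lemma generic_dense:
  assumes A: "A \<in> carrier_mat n n" and B: "generic n B" and e: "e > 0"
  shows "\<exists>C. generic n C \<and> (\<forall>i<n. \<forall>j<n. cmod (C $$ (i, j) - A $$ (i, j)) < e)"
proof -
  have Bc: "B \<in> carrier_mat n n" using B by (simp add: generic_def)
  \<comment> \<open>The summand 1 makes \<open>K\<close> positive even if \<open>A = B\<close>, so
    that \<open>e / K\<close> can bound \<open>t\<close>.\<close>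
  define K where "K = 1 + (\<Sum>ij \<in> {..<n} \<times> {..<n}. cmod (B $$ ij - A $$ ij))"
  have "K > 0" unfolding K_def by (intro add_pos_nonneg sum_nonneg) auto
  have K: "cmod (B $$ (i, j) - A $$ (i, j)) < K" if "i < n" "j < n" for i j
    using member_le_sum[of "(i, j)" "{..<n} \<times> {..<n}" "\<lambda>ij. cmod (B $$ ij - A $$ ij)"] that
    by (simp add: K_def)
  have "infinite ({0<..<e / K} - {t. \<not> generic n (A + of_real t \<cdot>\<^sub>m (B - A))})"
    using generic_on_line[OF A B] e \<open>K > 0\<close> infinite_Ioo[of 0 "e / K"]
    by (intro Diff_infinite_finite) auto
  then obtain t where t: "0 < t" "t < e / K" and g: "generic n (A + of_real t \<cdot>\<^sub>m (B - A))"
    by (auto dest!: infinite_imp_nonempty)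
  have "cmod ((A + of_real t \<cdot>\<^sub>m (B - A)) $$ (i, j) - A $$ (i, j)) < e" if ij: "i < n" "j < n" for i j
  proof -
    have "cmod ((A + of_real t \<cdot>\<^sub>m (B - A)) $$ (i, j) - A $$ (i, j))
        = t * cmod (B $$ (i, j) - A $$ (i, j))"
      using A Bc ij t by (simp add: norm_mult)
    also have "\<dots> \<le> t * K" using K[OF ij] t by simp
    also have "\<dots> < e" using t \<open>K > 0\<close> by (simp add: field_simps)
    finally show ?thesis .
  qed
  with g show ?thesis by blast
qed


section \<open>Reduction by eigenvectors of the pencil\<close>

text \<open>The value \<open>adj u * A * v\<close>: a bilinear form for the identity, a sesquilinear
  one for conjugation.\<close>

definition form :: "complex mat \<Rightarrow> complex vec \<Rightarrow> complex vec \<Rightarrow> complex" where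
  "form A u v = (\<Sum>i<dim_row A. tau (u $ i) * (A *\<^sub>v v) $ i)"

lemma mult_mat_vec_sum: "i < dim_row A \<Longrightarrow> dim_vec v = dim_col A \<Longrightarrow>
    (A *\<^sub>v v) $ i = (\<Sum>j<dim_col A. A $$ (i, j) * v $ j)"
  by (simp add: scalar_prod_def atLeast0LessThan)

lemma form_adj:
  assumes "A \<in> carrier_mat n n" "u \<in> carrier_vec n" "v \<in> carrier_vec n"
  shows "form (adj A) u v = tau (form A v u)"
proof -
  have "form (adj A) u v = (\<Sum>i<n. \<Sum>j<n. tau (u $ i) * (tau (A $$ (j, i)) * v $ j))"
    using assms by (simp add: form_def mult_mat_vec_sum sum_distrib_left del: index_mult_mat_vec)
  also have "\<dots> = (\<Sum>j<n. \<Sum>i<n. tau (u $ i) * (tau (A $$ (j, i)) * v $ j))"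
    by (rule sum.swap)
  also have "\<dots> = tau (form A v u)"
    using assms
    by (simp add: form_def mult_mat_vec_sum hom_sum sum_distrib_left mult_ac del: index_mult_mat_vec)
  finally show ?thesis .
qed

lemma form_smult:
  assumes "A \<in> carrier_mat n n" "u \<in> carrier_vec n" "v \<in> carrier_vec n"
  shows "form A (a \<cdot>\<^sub>v u) (b \<cdot>\<^sub>v v) = tau a * b * form A u v"
  using assms by (simp add: form_def sum_distrib_left mult_ac)

definition eigen :: "complex mat \<Rightarrow> complex \<Rightarrow> complex vec \<Rightarrow> bool" where
  "eigen A w v \<longleftrightarrow> v \<in> carrier_vec (dim_row A) \<and> v \<noteq> 0\<^sub>v (dim_row A) \<and>
     A *\<^sub>v v = w \<cdot>\<^sub>v (adj A *\<^sub>v v)"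

lemma eigen_exists:
  assumes A: "A \<in> carrier_mat n n" and w: "w \<in> pencil_roots A"
  shows "\<exists>v. eigen A w v"
proof -
  obtain v where v: "v \<in> carrier_vec n" "v \<noteq> 0\<^sub>v n" and e: "pencil A w *\<^sub>v v = 0\<^sub>v n"
    using w det_0_iff_vec_prod_zero[OF pencil_carrier[OF A], of w] by (auto simp: pencil_roots_def)
  have "(A *\<^sub>v v) $ i = (w \<cdot>\<^sub>v (adj A *\<^sub>v v)) $ i" if i: "i < n" for i
  proof -
    have "(A *\<^sub>v v) $ i - (w \<cdot>\<^sub>v (adj A *\<^sub>v v)) $ i = (pencil A w *\<^sub>v v) $ i"
      using A v i unfolding pencil_def
      by (simp add: mult_mat_vec_sum sum_distrib_left sum_subtractf algebra_simps del: index_mult_mat_vec)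
    then show ?thesis using e i by simp
  qed
  then have "A *\<^sub>v v = w \<cdot>\<^sub>v (adj A *\<^sub>v v)"
    using A by (intro eq_vecI) auto
  then show ?thesis using v A by (auto simp: eigen_def)
qed

lemma eigen_smult:
  assumes A: "A \<in> carrier_mat n n" and v: "eigen A w v" and c: "c \<noteq> 0"
  shows "eigen A w (c \<cdot>\<^sub>v v)"
proof -
  have vc: "v \<in> carrier_vec n" and v0: "v \<noteq> 0\<^sub>v n" using v A by (auto simp: eigen_def)
  obtain i where "i < n" "v $ i \<noteq> 0" using vc v0 by (metis carrier_vecD eq_vecI index_zero_vec)
  then have "(c \<cdot>\<^sub>v v) $ i \<noteq> 0\<^sub>v n $ i" using vc c by simp
  moreover have "A *\<^sub>v (c \<cdot>\<^sub>v v) = w \<cdot>\<^sub>v (adj A *\<^sub>v (c \<cdot>\<^sub>v v))"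
    unfolding mult_mat_vec[OF A vc] mult_mat_vec[OF adj_carrier[OF A] vc]
    using v by (simp add: eigen_def smult_smult_assoc mult.commute)
  ultimately show ?thesis using vc A by (auto simp: eigen_def)
qed

text \<open>The eigenvector equation replaces \<open>A\<close> by \<open>w\<close> times
  \<open>adj A\<close>, and passing from \<open>adj A\<close> back to \<open>A\<close> swaps the two
  arguments under \<open>tau\<close>.\<close>

lemma form_eigen:
  assumes A: "A \<in> carrier_mat n n" and u: "u \<in> carrier_vec n" and v: "eigen A w v"
  shows "form A u v = w * tau (form A v u)"
proof -
  have "form A u v = w * form (adj A) u v"
    using A v by (simp add: form_def eigen_def sum_distrib_left mult_ac del: index_mult_mat_vec)
  then show ?thesis using form_adj[OF A u] v A by (simp add: eigen_def)
qed

text \<open>Two uses of \<open>form_eigen\<close> return to the same value multiplied by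
  \<open>z * tau w\<close>, so a nonzero value forces this factor to be 1.\<close>

lemma form_eigen_eigen:
  assumes A: "A \<in> carrier_mat n n" and u: "eigen A w u" and v: "eigen A z v" and "form A u v \<noteq> 0"
  shows "z = inverse (tau w)"
proof -
  have c: "u \<in> carrier_vec n" "v \<in> carrier_vec n" using A u v by (auto simp: eigen_def)
  have "form A u v = z * tau (w * tau (form A u v))"
    using form_eigen[OF A c(1) v] form_eigen[OF A c(2) u] by simp
  then have "z * tau w = 1" using assms(4) by simp
  then show ?thesis by (metis inverse_unique mult.commute)
qed

text \<open>Independence of eigenvectors for distinct eigenvalues, in the setting of a pencil. With
  the eigenvectors as columns of \<open>X\<close> one has
  \<open>A * X = adj A * (X * mat_diag n l)\<close>; since \<open>adj A\<close> is invertible,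
  \<open>mat_diag n l\<close> maps the kernel of \<open>X\<close> into itself.\<close>

lemma eigen_det_nonzero:
  assumes A: "A \<in> carrier_mat n n" and dA: "det A \<noteq> 0" and l: "inj_on l {..<n}"
    and x: "\<And>j. j < n \<Longrightarrow> eigen A (l j) (x j)"
  shows "det (mat n n (\<lambda>(i, j). x j $ i)) \<noteq> 0"
proof
  define X where "X = mat n n (\<lambda>(i, j). x j $ i)"
  have X: "X \<in> carrier_mat n n" by (simp add: X_def)
  assume "det (mat n n (\<lambda>(i, j). x j $ i)) = 0"
  then obtain c where c: "c \<in> carrier_vec n" "c \<noteq> 0\<^sub>v n" "X *\<^sub>v c = 0\<^sub>v n"
    using det_0_iff_vec_prod_zero[OF X] by (auto simp: X_def)
  have xc: "x j \<in> carrier_vec n" if "j < n" for j using x[OF that] A by (simp add: eigen_def)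
  have AX: "A * X = adj A * (X * mat_diag n l)"
  proof (rule eq_matI)
    fix i j assume "i < dim_row (adj A * (X * mat_diag n l))" "j < dim_col (adj A * (X * mat_diag n l))"
    then have ij: "i < n" "j < n" using A by (auto simp: mat_diag_def)
    have "(A * X) $$ (i, j) = (A *\<^sub>v x j) $ i"
      using A X ij xc[OF ij(2)] by (simp add: mult_mat_vec_sum scalar_prod_def atLeast0LessThan X_def)
    also have "\<dots> = l j * (adj A *\<^sub>v x j) $ i"
      using x[OF ij(2)] A ij by (simp add: eigen_def del: index_mult_mat_vec)
    also have "\<dots> = (adj A * (X * mat_diag n l)) $$ (i, j)"
      using A X ij xc[OF ij(2)] unfolding mat_diag_mult_right[OF X]
      by (simp add: mult_mat_vec_sum scalar_prod_def atLeast0LessThan X_def sum_distrib_left mult_ac)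
    finally show "(A * X) $$ (i, j) = (adj A * (X * mat_diag n l)) $$ (i, j)" .
  qed (use A X in \<open>auto simp: mat_diag_def\<close>)
  have step: "X *\<^sub>v vec n (\<lambda>j. l j * d $ j) = 0\<^sub>v n"
    if d: "d \<in> carrier_vec n" "X *\<^sub>v d = 0\<^sub>v n" for d
  proof -
    have D: "mat_diag n l *\<^sub>v d = vec n (\<lambda>j. l j * d $ j)"
      using d by (intro eq_vecI)
        (auto simp: mult_mat_vec_sum mat_diag_def if_distrib[of "\<lambda>x. x * _"] cong: if_cong simp del: index_mult_mat_vec)
    have "adj A *\<^sub>v (X *\<^sub>v vec n (\<lambda>j. l j * d $ j)) = (adj A * (X * mat_diag n l)) *\<^sub>v d"
      using A X d adj_carrier[OF A] unfolding D[symmetric]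
      by (subst assoc_mult_mat_vec[of _ n n _ n], auto)+
    also have "\<dots> = A *\<^sub>v (X *\<^sub>v d)"
      unfolding AX[symmetric] using A X d by (intro assoc_mult_mat_vec) auto
    also have "\<dots> = 0\<^sub>v n" using A d by auto
    finally show ?thesis
      using det_0_iff_vec_prod_zero[OF adj_carrier[OF A]] det_adj[OF A] dA X
      by (metis mult_mat_vec_carrier tau_eq_0_iff vec_carrier)
  qed
  have shift: "X *\<^sub>v vec n (\<lambda>j. (l j - a) * d $ j) = 0\<^sub>v n"
    if d: "d \<in> carrier_vec n" "X *\<^sub>v d = 0\<^sub>v n" for a d
  proof (rule eq_vecI)
    fix i assume "i < dim_vec (0\<^sub>v n)"
    then have i: "i < n" by simp
    have "(X *\<^sub>v vec n (\<lambda>j. (l j - a) * d $ j)) $ i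
        = (X *\<^sub>v vec n (\<lambda>j. l j * d $ j)) $ i - a * (X *\<^sub>v d) $ i"
      using X d(1) i by (simp add: mult_mat_vec_sum sum_distrib_left sum_subtractf algebra_simps
          del: index_mult_mat_vec)
    then show "(X *\<^sub>v vec n (\<lambda>j. (l j - a) * d $ j)) $ i = 0\<^sub>v n $ i"
      using step[OF d] d i by (simp del: index_mult_mat_vec)
  qed (use X in auto)
  obtain m where m: "m < n" "c $ m \<noteq> 0" using c(1,2) by (metis carrier_vecD eq_vecI index_zero_vec)
  \<comment> \<open>The kernel of \<open>X\<close> is stable under multiplication of the \<open>j\<close>-th coordinates by \<open>l j - a\<close>, so
    all coordinates but one can be killed.\<close>
  have "X *\<^sub>v vec n (\<lambda>j. (\<Prod>k\<in>S. l j - l k) * c $ j) = 0\<^sub>v n" if "finite S" for S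
    using that
  proof (induction S)
    case empty
    have "vec n (\<lambda>j. (\<Prod>k\<in>{}. l j - l k) * c $ j) = c" using c(1) by (intro eq_vecI) auto
    then show ?case using c by simp
  next
    case (insert k S)
    have "vec n (\<lambda>j. (\<Prod>k\<in>insert k S. l j - l k) * c $ j)
        = vec n (\<lambda>j. (l j - l k) * vec n (\<lambda>j. (\<Prod>k\<in>S. l j - l k) * c $ j) $ j)"
      using insert.hyps by (intro eq_vecI) (auto simp: mult_ac)
    then show ?case using shift[OF _ insert.IH, of "l k"] by simp
  qed
  from this[of "{..<n} - {m}"]
  have z: "X *\<^sub>v vec n (\<lambda>j. (\<Prod>k\<in>{..<n} - {m}. l j - l k) * c $ j) = 0\<^sub>v n" by simp
  have "(\<Prod>k\<in>{..<n} - {m}. l m - l k) * c $ m * x m $ i = 0" if i: "i < n" for i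
  proof -
    have "(X *\<^sub>v vec n (\<lambda>j. (\<Prod>k\<in>{..<n} - {m}. l j - l k) * c $ j)) $ i
        = (\<Sum>j<n. x j $ i * ((\<Prod>k\<in>{..<n} - {m}. l j - l k) * c $ j))"
      using X i by (simp add: mult_mat_vec_sum X_def del: index_mult_mat_vec)
    also have "\<dots> = (\<Sum>j<n. if j = m then (\<Prod>k\<in>{..<n} - {m}. l m - l k) * c $ m * x m $ i else 0)"
    proof (rule sum.cong[OF refl])
      fix j assume j: "j \<in> {..<n}"
      show "x j $ i * ((\<Prod>k\<in>{..<n} - {m}. l j - l k) * c $ j) =
          (if j = m then (\<Prod>k\<in>{..<n} - {m}. l m - l k) * c $ m * x m $ i else 0)"
      proof (cases "j = m")
        case False
        then have "(\<Prod>k\<in>{..<n} - {m}. l j - l k) = 0"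
          using j by (intro prod_zero) auto
        then show ?thesis using False by simp
      qed simp
    qed
    also have "\<dots> = (\<Prod>k\<in>{..<n} - {m}. l m - l k) * c $ m * x m $ i" using m by simp
    finally show ?thesis using z i by simp
  qed
  moreover have "(\<Prod>k\<in>{..<n} - {m}. l m - l k) \<noteq> 0"
    using l m by (auto simp: inj_on_def)
  ultimately have "x m $ i = 0" if "i < n" for i using m that by simp
  then have "x m = 0\<^sub>v n" using xc[OF m(1)] by (intro eq_vecI) auto
  then show False using x[OF m(1)] A by (simp add: eigen_def)
qed

end

section \<open>Gram matrices along lists of roots and their block structure\<close>

definition mat_of_list :: "('a \<Rightarrow> 'a \<Rightarrow> 'b) \<Rightarrow> 'a list \<Rightarrow> 'b mat" where
  "mat_of_list h ws = mat (length ws) (length ws) (\<lambda>(i, j). h (ws ! i) (ws ! j))"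

lemma mat_of_list_append:
  assumes "\<forall>u\<in>set us. \<forall>v\<in>set vs. h u v = 0 \<and> h v u = 0"
  shows "mat_of_list h (us @ vs) = four_block_mat (mat_of_list h us)
    (0\<^sub>m (length us) (length vs)) (0\<^sub>m (length vs) (length us)) (mat_of_list h vs)"
  using assms by (intro eq_matI) (auto simp: mat_of_list_def nth_append)

lemma mat_of_list_concat:
  assumes "sorted_wrt (\<lambda>us vs. \<forall>u\<in>set us. \<forall>v\<in>set vs. h u v = 0 \<and> h v u = 0) wss"
  shows "mat_of_list h (concat wss) = diag_block_mat (map (mat_of_list h) wss)"
  using assms
proof (induction wss)
  case Nil
  then show ?case by (auto simp: mat_of_list_def)
next
  case (Cons ws wss)
  have "mat_of_list h (concat (ws # wss)) = four_block_mat (mat_of_list h ws)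
      (0\<^sub>m (length ws) (length (concat wss))) (0\<^sub>m (length (concat wss)) (length ws))
      (mat_of_list h (concat wss))"
    unfolding concat.simps using Cons.prems by (intro mat_of_list_append) auto
  moreover have "mat_of_list h (concat wss) = diag_block_mat (map (mat_of_list h) wss)"
    using Cons by auto
  moreover have "dim_row (mat_of_list h us) = length us" "dim_col (mat_of_list h us) = length us" for us
    by (simp_all add: mat_of_list_def)
  ultimately show ?case unfolding list.map diag_block_mat.simps Let_def by metis
qed

lemma distinct_concat_nth_disjoint:
  assumes "distinct (concat xss)" "i < j" "j < length xss"
  shows "set (xss ! i) \<inter> set (xss ! j) = {}"
proof -
  have "distinct (concat (take j xss) @ concat (drop j xss))"
    using assms(1) by (simp flip: concat_append)
  then have "set (concat (take j xss)) \<inter> set (concat (drop j xss)) = {}" by simp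
  moreover have "xss ! i \<in> set (take j xss)"
    using assms(2,3) nth_mem[of i "take j xss"] by simp
  moreover have "xss ! j \<in> set (drop j xss)"
    using assms(3) nth_mem[of 0 "drop j xss"] by simp
  ultimately show ?thesis unfolding set_concat by blast
qed

lemma mat_of_list_singleton: "mat_of_list h [w] = scalar_block (h w w)"
  by (rule eq_matI) (auto simp: mat_of_list_def scalar_block_def)

text \<open>The order of the list matters: with \<open>r\<close> first, the entry 1 lands in the
  upper right corner, where \<open>H_block\<close> has its identity block, and the parameter in the
  lower left one.\<close>

lemma mat_of_list_pair:
  assumes "h r r = 0" "h s s = 0" "h r s = 1"
  shows "mat_of_list h [r, s] = H_block 1 (h s r)"
  by (rule eq_matI)
    (use assms in \<open>auto simp: mat_of_list_def H_block_def jordan_block_def less_2_cases_iff\<close>)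

text \<open>The shape of a canonical form without Type 0 blocks in which every index is 1.\<close>

definition simple_form :: "complex list \<Rightarrow> complex list \<Rightarrow> complex mat" where
  "simple_form cs rs = diag_block_mat (map scalar_block cs @ map (H_block 1) rs)"

context involution begin

text \<open>The Gram matrix of an eigenbasis has exactly one nonzero entry in each row, at the
  reflected root, so grouping the roots into orbits of the reflection makes it block diagonal.
  \<open>fs\<close> holds the fixed roots and \<open>rs\<close> one root of each pair.
  \<open>N\<close> is the normalisation that rescaling an eigenvector can reach: equality with 1 for
  congruence, modulus 1 for *congruence. The relation between \<open>cs\<close> and
  \<open>fs\<close> lets the fixed roots be read off the blocks.\<close>

theorem normal_form:
  assumes A: "A \<in> carrier_mat n n" and dA: "det A \<noteq> 0"
    and ws_def: "ws = fs @ concat (map (\<lambda>r. [r, inverse (tau r)]) rs)"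
    and dws: "distinct ws" and lenws: "length ws = n" and roots: "set ws \<subseteq> pencil_roots A"
    and fs: "\<And>f. f \<in> set fs \<Longrightarrow> f * tau f = 1"
    and scale: "\<And>c. c \<noteq> 0 \<Longrightarrow> \<exists>s. s \<noteq> 0 \<and> N (tau s * s * c)"
  shows "\<exists>X cs. X \<in> carrier_mat n n \<and> det X \<noteq> 0 \<and> length cs = length fs \<and>
    (\<forall>i<length fs. N (cs ! i) \<and> cs ! i = fs ! i * tau (cs ! i)) \<and>
    adj X * A * X = simple_form cs rs"
proof -
  have rinv: "\<And>r. inverse (tau (inverse (tau r))) = r" by (simp add: tau_inverse)
  have finv: "inverse (tau f) = f" if "f \<in> set fs" for f
    using fs[OF that] by (metis inverse_unique mult.commute)
  have closed: "inverse (tau w) \<in> set ws" if "w \<in> set ws" for w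
    using that finv rinv by (auto simp: ws_def)
  define X where "X y = mat n n (\<lambda>(i, j). y (ws ! j) $ i)" for y :: "complex \<Rightarrow> complex vec"
  have X: "X y \<in> carrier_mat n n" for y by (simp add: X_def)
  define h where "h y u v = form A (y u) (y v)" for y :: "complex \<Rightarrow> complex vec" and u v
  have cong: "adj (X y) * A * X y = mat_of_list (h y) ws"
    if y: "\<And>w. w \<in> set ws \<Longrightarrow> eigen A w (y w)" for y
  proof (rule eq_matI)
    fix i j assume "i < dim_row (mat_of_list (h y) ws)" "j < dim_col (mat_of_list (h y) ws)"
    then have ij: "i < n" "j < n" by (simp_all add: mat_of_list_def lenws)
    have yc: "y (ws ! j) \<in> carrier_vec n" using y[of "ws ! j"] A ij lenws by (simp add: eigen_def)
    have "adj (X y) * A * X y = adj (X y) * (A * X y)"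
      using A X[of y] adj_carrier[OF X[of y]] by (intro assoc_mult_mat)
    moreover have "(A * X y) $$ (k, j) = (A *\<^sub>v y (ws ! j)) $ k" if "k < n" for k
      using A ij that yc by (simp add: mult_mat_vec_sum scalar_prod_def atLeast0LessThan X_def)
    ultimately have "(adj (X y) * A * X y) $$ (i, j)
        = (\<Sum>k<n. tau (y (ws ! i) $ k) * (A *\<^sub>v y (ws ! j)) $ k)"
      using A X[of y] ij adj_carrier[OF X[of y]]
      by (subst \<open>adj (X y) * A * X y = _\<close>, subst index_mult_mat)
        (auto simp: scalar_prod_def atLeast0LessThan X_def intro!: sum.cong)
    then show "(adj (X y) * A * X y) $$ (i, j) = mat_of_list (h y) ws $$ (i, j)"
      using ij lenws A by (simp add: mat_of_list_def h_def form_def)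
  qed (use X[of y] in \<open>auto simp: mat_of_list_def lenws\<close>)
  have detX: "det (X y) \<noteq> 0" if y: "\<And>w. w \<in> set ws \<Longrightarrow> eigen A w (y w)" for y
    unfolding X_def
    by (rule eigen_det_nonzero[OF A dA, of "\<lambda>i. ws ! i"])
      (use y dws lenws in \<open>auto simp: inj_on_nth\<close>)
  have h0: "h y u v = 0"
    if y: "\<And>w. w \<in> set ws \<Longrightarrow> eigen A w (y w)" and uv: "u \<in> set ws" "v \<in> set ws"
      and ne: "v \<noteq> inverse (tau u)" for y u v
    using form_eigen_eigen[OF A y[OF uv(1)] y[OF uv(2)]] ne by (auto simp: h_def)
  \<comment> \<open>In row \<open>u\<close> of the Gram matrix only the entry at
    \<open>inverse (tau u)\<close> can differ from 0, so its vanishing would make an invertible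
    matrix singular.\<close>
  have h1: "h y u (inverse (tau u)) \<noteq> 0"
    if y: "\<And>w. w \<in> set ws \<Longrightarrow> eigen A w (y w)" and u: "u \<in> set ws" for y u
  proof
    assume 0: "h y u (inverse (tau u)) = 0"
    obtain i where i: "i < n" "ws ! i = u" using u lenws by (metis in_set_conv_nth)
    have "h y u v = 0" if "v \<in> set ws" for v using h0[OF y u that] 0 by blast
    then have "mat_of_list (h y) ws $$ (i, j) = 0" if "j < n" for j
      using i that lenws by (simp add: mat_of_list_def)
    moreover have "mat_of_list (h y) ws \<in> carrier_mat n n" by (simp add: mat_of_list_def lenws)
    ultimately have "det (mat_of_list (h y) ws) = 0"
      using i(1) by (simp add: laplace_expansion_row[of _ n i])
    moreover have "det (adj (X y) * A * X y) = tau (det (X y)) * det A * det (X y)"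
      unfolding det_mult[OF mult_carrier_mat[OF adj_carrier[OF X[of y]] A] X[of y]]
        det_mult[OF adj_carrier[OF X[of y]] A] det_adj[OF X[of y]] ..
    ultimately show False using detX[OF y] dA cong[OF y] by simp
  qed
  have hrel: "h y u v = v * tau (h y v u)"
    if y: "\<And>w. w \<in> set ws \<Longrightarrow> eigen A w (y w)" and uv: "u \<in> set ws" "v \<in> set ws" for y u v
    unfolding h_def using y[OF uv(1)] A by (intro form_eigen[OF A _ y[OF uv(2)]]) (simp add: eigen_def)
  have "\<forall>w\<in>set ws. \<exists>v. eigen A w v" using eigen_exists[OF A] roots by auto
  then obtain x where x: "\<And>w. w \<in> set ws \<Longrightarrow> eigen A w (x w)" by metis
  have "\<forall>w\<in>set fs. \<exists>s. s \<noteq> 0 \<and> N (tau s * s * h x w w)"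
    using scale h1[OF x] finv by (metis UnCI set_append ws_def)
  then obtain sf where sf: "\<And>w. w \<in> set fs \<Longrightarrow> sf w \<noteq> 0 \<and> N (tau (sf w) * sf w * h x w w)" by metis
  \<comment> \<open>Fixed roots get the scale that achieves \<open>N\<close>, the chosen roots
    \<open>rs\<close> keep their eigenvectors, and the partner of a chosen root absorbs the value of
    the form on the pair, which thereby becomes 1.\<close>
  define s where "s w = (if w \<in> set fs then sf w else
    if w \<in> set rs then 1 else inverse (h x (inverse (tau w)) w))" for w
  have s0: "s w \<noteq> 0" if "w \<in> set ws" for w
    using sf h1[OF x closed[OF that]] rinv[of w] by (simp add: s_def)
  define y where "y w = s w \<cdot>\<^sub>v x w" for w
  have y: "eigen A w (y w)" if "w \<in> set ws" for w
    unfolding y_def by (rule eigen_smult[OF A x[OF that] s0[OF that]])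
  have hy: "h y u v = tau (s u) * s v * h x u v" if "u \<in> set ws" "v \<in> set ws" for u v
    unfolding h_def y_def using x[OF that(1)] x[OF that(2)] A
    by (intro form_smult[OF A]) (simp_all add: eigen_def)
  define cs where "cs = map (\<lambda>f. h y f f) fs"
  have hr: "h y r r = 0" "h y (inverse (tau r)) (inverse (tau r)) = 0"
     "h y r (inverse (tau r)) = 1" "h y (inverse (tau r)) r = r" if r: "r \<in> set rs" for r
  proof -
    have mem: "r \<in> set ws" "inverse (tau r) \<in> set ws" using r by (auto simp: ws_def)
    have ne: "r \<noteq> inverse (tau r)"
    proof -
      obtain as bs where "rs = as @ r # bs" using r by (meson split_list)
      then show ?thesis using dws by (auto simp: ws_def)
    qed
    have nfs: "r \<notin> set fs" "inverse (tau r) \<notin> set fs" using dws r by (auto simp: ws_def)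
    have nrs: "inverse (tau r) \<notin> set rs"
    proof
      assume s: "inverse (tau r) \<in> set rs"
      have "distinct (concat (map (\<lambda>r. [r, inverse (tau r)]) rs))" using dws by (simp add: ws_def)
      then have "set [r, inverse (tau r)] \<inter> set [inverse (tau r), inverse (tau (inverse (tau r)))] = {}"
        unfolding distinct_concat_iff using r s ne
        by (smt (verit) image_eqI list.inject list.set_map)
      then show False by simp
    qed
    show "h y r r = 0" using h0[OF y mem(1) mem(1)] ne by simp
    show "h y (inverse (tau r)) (inverse (tau r)) = 0" using h0[OF y mem(2) mem(2)] rinv[of r] ne by simp
    show "h y r (inverse (tau r)) = 1"
      using h1[OF x mem(1)] nfs nrs r rinv[of r] by (simp add: hy[OF mem] s_def)
    then show "h y (inverse (tau r)) r = r" using hrel[OF y mem(2) mem(1)] by simp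
  qed
  have "mat_of_list (h y) (concat (map (\<lambda>f. [f]) fs @ map (\<lambda>r. [r, inverse (tau r)]) rs))
    = diag_block_mat (map (mat_of_list (h y)) (map (\<lambda>f. [f]) fs @ map (\<lambda>r. [r, inverse (tau r)]) rs))"
    (is "mat_of_list _ (concat ?wss) = _")
  proof (rule mat_of_list_concat)
    have cc: "concat ?wss = ws" by (simp add: ws_def)
    note * = distinct_concat_nth_disjoint[OF dws[folded cc]]
    have in_ws: "u \<in> set ws" if "us \<in> set ?wss" "u \<in> set us" for us u
      using that unfolding cc[symmetric] set_concat by blast
    have inv_in: "inverse (tau u) \<in> set us" if "us \<in> set ?wss" "u \<in> set us" for us u
      using that finv rinv by auto
    show "sorted_wrt (\<lambda>us vs. \<forall>u\<in>set us. \<forall>v\<in>set vs. h y u v = 0 \<and> h y v u = 0) ?wss"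
      unfolding sorted_wrt_iff_nth_less
    proof (intro allI impI ballI)
      fix i j u v assume ij: "i < j" "j < length ?wss" and u: "u \<in> set (?wss ! i)" and v: "v \<in> set (?wss ! j)"
      have m: "?wss ! i \<in> set ?wss" "?wss ! j \<in> set ?wss" using ij by (meson nth_mem order_less_trans)+
      have "v \<noteq> inverse (tau u)" "u \<noteq> inverse (tau v)"
        using inv_in[OF m(1) u] inv_in[OF m(2) v] u v *[OF ij] by blast+
      then show "h y u v = 0 \<and> h y v u = 0"
        using h0[OF y] in_ws[OF m(1) u] in_ws[OF m(2) v] by blast
    qed
  qed
  also have "map (mat_of_list (h y)) ?wss = map scalar_block cs @ map (H_block 1) rs"
    using hr by (auto simp: cs_def mat_of_list_singleton mat_of_list_pair)
  finally have "adj (X y) * A * X y = simple_form cs rs"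
    using cong[OF y] by (simp add: simple_form_def ws_def)
  moreover have "N (cs ! i) \<and> cs ! i = fs ! i * tau (cs ! i)" if i: "i < length fs" for i
  proof -
    have m: "fs ! i \<in> set fs" "fs ! i \<in> set ws" using i by (auto simp: ws_def)
    show ?thesis using i sf[OF m(1)] hrel[OF y m(2) m(2)] m(1)
      by (simp add: cs_def hy[OF m(2) m(2)] s_def)
  qed
  ultimately show ?thesis using X[of y] detX[OF y] by (intro exI[of _ "X y"] exI[of _ cs]) (simp add: cs_def)
qed


text \<open>A selector picks one root out of each pair \<open>r\<close>, \<open>1 / tau r\<close>.\<close>

definition selector :: "(complex \<Rightarrow> bool) \<Rightarrow> bool" where
  "selector S \<longleftrightarrow> (\<forall>r. r \<noteq> 0 \<longrightarrow> r * tau r \<noteq> 1 \<longrightarrow> S r \<noteq> S (inverse (tau r)))"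

lemma inverse_tau_inverse_tau [simp]: "inverse (tau (inverse (tau r))) = r"
  by (simp add: tau_inverse)

lemma fixed_iff: "r * tau r = 1 \<longleftrightarrow> r \<noteq> 0 \<and> inverse (tau r) = r"
  by (metis inverse_unique left_inverse mult.commute mult_zero_left tau_eq_0_iff zero_neq_one)

text \<open>\<open>S\<close> holds on \<open>rs\<close> and fails on the reflections, so a chosen
  root never equals the partner of another one; the fixed roots belong to no pair.\<close>

lemma distinct_root_list:
  assumes S: "selector S" and fs: "distinct fs" "\<forall>f\<in>set fs. f * tau f = 1"
    and rs: "distinct rs" "\<forall>r\<in>set rs. r \<noteq> 0 \<and> r * tau r \<noteq> 1 \<and> S r"
  shows "distinct (fs @ concat (map (\<lambda>r. [r, inverse (tau r)]) rs))"
proof -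
  have "distinct (concat (map (\<lambda>r. [r, inverse (tau r)]) rs))"
    using rs
  proof (induction rs)
    case (Cons r rs)
    have r: "r \<noteq> inverse (tau r)" "S r" "\<not> S (inverse (tau r))"
      using Cons.prems S by (auto simp: fixed_iff selector_def)
    have rs: "\<not> S (inverse (tau s)) \<and> S s" if "s \<in> set rs" for s
      using Cons.prems S that by (auto simp: selector_def)
    have a: "inverse (tau s) \<noteq> inverse (tau r)" "s \<noteq> r" if "s \<in> set rs" for s
      using that Cons.prems by (metis inverse_tau_inverse_tau distinct.simps(2))+
    have b: "inverse (tau s) \<noteq> r" "s \<noteq> inverse (tau r)" if "s \<in> set rs" for s
      using r(2,3) rs[OF that] by metis+
    have "r \<noteq> s \<and> r \<noteq> inverse (tau s) \<and> inverse (tau r) \<noteq> s \<and> inverse (tau r) \<noteq> inverse (tau s)"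
      if s: "s \<in> set rs" for s
      by (intro conjI not_sym[OF a(1)[OF s]] not_sym[OF a(2)[OF s]] not_sym[OF b(1)[OF s]]
          not_sym[OF b(2)[OF s]])
    then have "r \<notin> set (concat (map (\<lambda>r. [r, inverse (tau r)]) rs))"
      "inverse (tau r) \<notin> set (concat (map (\<lambda>r. [r, inverse (tau r)]) rs))"
      by force+
    moreover have "distinct (concat (map (\<lambda>r. [r, inverse (tau r)]) rs))"
      using Cons.IH Cons.prems by simp
    ultimately show ?case using r(1) by simp
  qed simp
  moreover have "set fs \<inter> set (concat (map (\<lambda>r. [r, inverse (tau r)]) rs)) = {}"
  proof -
    have "r \<notin> set fs" "inverse (tau r) \<notin> set fs" if "r \<in> set rs" for r
      using fs(2) rs(2) that by (metis fixed_iff inverse_tau_inverse_tau)+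
    then show ?thesis by auto
  qed
  ultimately show ?thesis using fs by simp
qed

lemma root_list_exists:
  assumes S: "selector S" and g: "generic n A"
  shows "\<exists>fs rs. distinct (fs @ concat (map (\<lambda>r. [r, inverse (tau r)]) rs)) \<and>
    set (fs @ concat (map (\<lambda>r. [r, inverse (tau r)]) rs)) = pencil_roots A \<and>
    distinct rs \<and> (\<forall>r\<in>set rs. S r) \<and> set fs = {r \<in> pencil_roots A. r * tau r = 1}"
proof -
  have A: "A \<in> carrier_mat n n" and d: "det A \<noteq> 0" using g by (auto simp: generic_def)
  note fin = finite_pencil_roots[OF A d]
  obtain fs where fs: "set fs = {r \<in> pencil_roots A. r * tau r = 1}" "distinct fs"
    using finite_distinct_list[of "{r \<in> pencil_roots A. r * tau r = 1}"] fin by auto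
  obtain rs where rs: "set rs = {r \<in> pencil_roots A. r * tau r \<noteq> 1 \<and> S r}" "distinct rs"
    using finite_distinct_list[of "{r \<in> pencil_roots A. r * tau r \<noteq> 1 \<and> S r}"] fin by auto
  note nz = pencil_roots_nonzero[OF A d] and rec = pencil_roots_reciprocal[OF A d]
  have "distinct (fs @ concat (map (\<lambda>r. [r, inverse (tau r)]) rs))"
    using fs rs nz by (intro distinct_root_list[OF S]) auto
  moreover have "set (fs @ concat (map (\<lambda>r. [r, inverse (tau r)]) rs)) = pencil_roots A"
  proof (intro equalityI subsetI)
    fix r assume r: "r \<in> pencil_roots A"
    show "r \<in> set (fs @ concat (map (\<lambda>r. [r, inverse (tau r)]) rs))"
    proof (cases "r * tau r = 1 \<or> S r")
      case True
      then show ?thesis using r fs rs by auto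
    next
      case False
      then have "S (inverse (tau r))" using S nz[OF r] unfolding selector_def by blast
      moreover have "inverse (tau r) * tau (inverse (tau r)) \<noteq> 1"
        using False nz[OF r] by (auto simp: fixed_iff)
      ultimately have "inverse (tau r) \<in> set rs" using rec[OF r] rs by simp
      then have "r \<in> (\<Union>r\<in>set rs. {r, inverse (tau r)})"
        by (intro UN_I) auto
      then show ?thesis by auto
    qed
  qed (use fs rs rec in auto)
  ultimately show ?thesis using fs rs by blast
qed

text \<open>The last clause is the distinctness of the fixed roots, which are the quotients
  \<open>c / tau c\<close>, written without division.\<close>

theorem generic_normal_form:
  assumes S: "selector S" and g: "generic n A"
    and scale: "\<And>c. c \<noteq> 0 \<Longrightarrow> \<exists>s. s \<noteq> 0 \<and> N (tau s * s * c)"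
  obtains X cs rs where "X \<in> carrier_mat n n" "det X \<noteq> 0" "adj X * A * X = simple_form cs rs"
    "\<forall>c\<in>set cs. N c" "distinct rs" "\<forall>r\<in>set rs. S r" "length cs + 2 * length rs = n"
    "length cs = card {r \<in> pencil_roots A. r * tau r = 1}"
    "\<forall>i<length cs. \<forall>j<length cs. i \<noteq> j \<longrightarrow> cs ! i * tau (cs ! j) \<noteq> cs ! j * tau (cs ! i)"
proof -
  have A: "A \<in> carrier_mat n n" and d: "det A \<noteq> 0" and c: "card (pencil_roots A) = n"
    using g by (auto simp: generic_def)
  obtain fs rs where ws: "distinct (fs @ concat (map (\<lambda>r. [r, inverse (tau r)]) rs))"
      "set (fs @ concat (map (\<lambda>r. [r, inverse (tau r)]) rs)) = pencil_roots A"
    and rs: "distinct rs" "\<forall>r\<in>set rs. S r" and fs: "set fs = {r \<in> pencil_roots A. r * tau r = 1}"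
    using root_list_exists[OF S g] by blast
  have dfs: "distinct fs" using ws(1) by simp
  have len: "length (fs @ concat (map (\<lambda>r. [r, inverse (tau r)]) rs)) = n"
    using distinct_card[OF ws(1)] ws(2) c by simp
  have "length (concat (map (\<lambda>r. [r, inverse (tau r)]) rs)) = 2 * length rs"
    by (induction rs) auto
  then have len': "length fs + 2 * length rs = n" using len by simp
  \<comment> \<open>\<open>N\<close> is strengthened by nonvanishing: an arbitrary \<open>N\<close>
    might admit 0, and the comparison of the scalars below cancels a product of their images under
    \<open>tau\<close>.\<close>
  have "\<exists>X cs. X \<in> carrier_mat n n \<and> det X \<noteq> 0 \<and> length cs = length fs \<and>
    (\<forall>i<length fs. (N (cs ! i) \<and> cs ! i \<noteq> 0) \<and> cs ! i = fs ! i * tau (cs ! i)) \<and>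
    adj X * A * X = simple_form cs rs"
  proof (rule normal_form[OF A d refl ws(1) len])
    show "set (fs @ concat (map (\<lambda>r. [r, inverse (tau r)]) rs)) \<subseteq> pencil_roots A" using ws(2) by simp
    show "f * tau f = 1" if "f \<in> set fs" for f using that fs by simp
    show "\<exists>s. s \<noteq> 0 \<and> N (tau s * s * c) \<and> tau s * s * c \<noteq> 0" if "c \<noteq> 0" for c
      using scale[OF that] that by auto
  qed
  then obtain X cs where X: "X \<in> carrier_mat n n" "det X \<noteq> 0" "adj X * A * X = simple_form cs rs"
    and cs: "length cs = length fs"
      "\<And>i. i < length fs \<Longrightarrow> N (cs ! i) \<and> cs ! i \<noteq> 0 \<and> cs ! i = fs ! i * tau (cs ! i)" by blast
  have neq: "cs ! i * tau (cs ! j) \<noteq> cs ! j * tau (cs ! i)"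
    if ij: "i < length cs" "j < length cs" "i \<noteq> j" for i j
  proof -
    have "cs ! i * tau (cs ! j) = fs ! i * (tau (cs ! i) * tau (cs ! j))"
      using cs(2)[of i] ij cs(1) by (metis mult.assoc)
    moreover have "cs ! j * tau (cs ! i) = fs ! j * (tau (cs ! i) * tau (cs ! j))"
      using cs(2)[of j] ij cs(1) by (metis mult.assoc mult.commute)
    moreover have "fs ! i \<noteq> fs ! j" using dfs ij cs(1) by (simp add: nth_eq_iff_index_eq)
    moreover have "tau (cs ! i) * tau (cs ! j) \<noteq> 0" using cs(2)[of i] cs(2)[of j] ij cs(1) by simp
    ultimately show ?thesis
      by (metis mult_right_cancel)
  qed
  show ?thesis
  proof (rule that[OF X])
    show "\<forall>c\<in>set cs. N c" using cs by (auto simp: in_set_conv_nth)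
    show "length cs = card {r \<in> pencil_roots A. r * tau r = 1}"
      using distinct_card[OF dfs] fs cs by simp
  qed (use rs len' cs neq in auto)
qed

section \<open>Pencil roots of the canonical blocks\<close>

lemma pencil_roots_diag_block:
  assumes "\<forall>B\<in>set Bs. square_mat B"
  shows "pencil_roots (diag_block_mat Bs) = (\<Union>B\<in>set Bs. pencil_roots B)"
  unfolding pencil_roots_def det_pencil_diag_block[OF assms] by (auto simp: prod_list_zero_iff)

lemma det_four_block_antidiagonal:
  fixes B C :: "'a :: idom mat"
  assumes "B \<in> carrier_mat k k" "C \<in> carrier_mat k k"
  shows "det (four_block_mat (0\<^sub>m k k) B C (0\<^sub>m k k)) = (- 1) ^ k * (det B * det C)"
proof -
  have "det (four_block_mat (0\<^sub>m k k) B C (0\<^sub>m k k)) = det (0\<^sub>m k k * 0\<^sub>m k k - B * C)"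
    using assms by (intro det_four_block_mat) auto
  also have "0\<^sub>m k k * 0\<^sub>m k k - B * C = (- 1) \<cdot>\<^sub>m (B * C)"
    using assms by (intro eq_matI) auto
  also have "det \<dots> = (- 1) ^ k * (det B * det C)"
    using assms by (simp add: det_mult[of _ k])
  finally show ?thesis .
qed

lemma pencil_H_block:
  "pencil (H_block k m) z = four_block_mat (0\<^sub>m k k) (1\<^sub>m k - z \<cdot>\<^sub>m adj (jordan_block k m))
     (jordan_block k m - z \<cdot>\<^sub>m 1\<^sub>m k) (0\<^sub>m k k)"
  by (rule eq_matI) (auto simp: pencil_def H_block_def)

text \<open>The pencil is block antidiagonal, with an upper triangular block of diagonal
  \<open>m - z\<close> and a lower triangular one of diagonal \<open>1 - z * tau m\<close>.\<close>

lemma det_pencil_H_block: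
  "det (pencil (H_block k m) z) = (- 1) ^ k * ((1 - z * tau m) ^ k * (m - z) ^ k)"
proof -
  let ?U = "jordan_block k m - z \<cdot>\<^sub>m 1\<^sub>m k" and ?L = "1\<^sub>m k - z \<cdot>\<^sub>m adj (jordan_block k m)"
  have c: "?U \<in> carrier_mat k k" "?L \<in> carrier_mat k k"
    by (auto intro!: minus_carrier_mat)
  have "det ?U = (m - z) ^ k"
    by (subst det_upper_triangular[OF _ c(1)]) (auto simp: prod_list_diag_prod)
  moreover have "det ?L = (1 - z * tau m) ^ k"
    by (subst det_lower_triangular[OF _ c(2)]) (auto simp: prod_list_diag_prod)
  ultimately show ?thesis
    unfolding pencil_H_block det_four_block_antidiagonal[OF c(2,1)] by simp
qed

lemma pencil_roots_H_block: "m \<noteq> 0 \<Longrightarrow> k > 0 \<Longrightarrow> pencil_roots (H_block k m) = {m, inverse (tau m)}"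
  by (auto simp: pencil_roots_def det_pencil_H_block field_simps)

lemma pencil_roots_scalar:
  assumes "c \<noteq> 0"
  shows "pencil_roots (scalar_block c) = {c / tau c}"
proof -
  have "det (pencil (scalar_block c) z) = c - z * tau c" for z
    by (subst det_single) (auto simp: pencil_def scalar_block_def)
  then have "pencil_roots (scalar_block c) = {z. c - z * tau c = 0}"
    by (simp add: pencil_roots_def)
  moreover have "c - z * tau c = 0 \<longleftrightarrow> z = c / tau c" for z
    using assms by (metis eq_divide_eq right_minus_eq tau_eq_0_iff)
  ultimately show ?thesis by simp
qed

text \<open>\<open>Bs\<close> is given through its set only, because the roots ignore the order of
  the blocks and this order differs between \<open>simple_form\<close> and the representatives of
  the bundles. Repetitions are controlled by the size \<open>n\<close>, which is the number of
  distinct roots.\<close>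

lemma generic_diag_block:
  assumes Bs: "set Bs = set (map scalar_block cs @ map (H_block 1) rs)"
    and nz: "0 \<notin> set cs" "0 \<notin> set rs"
    and ws: "ws = map (\<lambda>c. c / tau c) cs @ concat (map (\<lambda>r. [r, inverse (tau r)]) rs)"
    and d: "distinct ws" "length ws = n" and c: "diag_block_mat Bs \<in> carrier_mat n n"
  shows "generic n (diag_block_mat Bs)" "pencil_roots (diag_block_mat Bs) = set ws"
proof -
  have "\<forall>B\<in>set Bs. square_mat B" unfolding Bs by (auto simp: scalar_block_def H_block_def)
  from pencil_roots_diag_block[OF this]
  have "pencil_roots (diag_block_mat Bs)
      = (\<Union>c\<in>set cs. pencil_roots (scalar_block c)) \<union> (\<Union>r\<in>set rs. pencil_roots (H_block 1 r))"
    unfolding Bs by auto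
  also have "\<dots> = (\<Union>c\<in>set cs. {c / tau c}) \<union> (\<Union>r\<in>set rs. {r, inverse (tau r)})"
    using nz by (intro arg_cong2[of _ _ _ _ "(\<union>)"] SUP_cong refl pencil_roots_scalar pencil_roots_H_block) auto
  also have "\<dots> = set ws" by (auto simp: ws)
  finally show r: "pencil_roots (diag_block_mat Bs) = set ws" .
  have "0 \<notin> set ws" using nz by (auto simp: ws)
  then have "det (diag_block_mat Bs) \<noteq> 0"
    unfolding r[symmetric] pencil_roots_def by (simp add: pencil_0[OF c])
  then show "generic n (diag_block_mat Bs)" using c d r distinct_card[OF d(1)] by (simp add: generic_def)
qed

end

section \<open>Inverses and the inversion of congruences\<close>

lemma det_nonzero_obtain_inverse:
  fixes X :: "'a :: field mat"
  assumes X: "X \<in> carrier_mat n n" and d: "det X \<noteq> 0"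
  obtains Y where "Y \<in> carrier_mat n n" "X * Y = 1\<^sub>m n" "Y * X = 1\<^sub>m n"
  using det_non_zero_imp_unit[OF X d, of "()"] by (auto simp: Units_def ring_mat_simps)

lemma invertible_mat_iff_det_nonzero:
  fixes A :: "'a :: field mat"
  assumes A: "A \<in> carrier_mat n n"
  shows "invertible_mat A \<longleftrightarrow> det A \<noteq> 0"
proof
  assume "invertible_mat A"
  then obtain B where B: "A * B = 1\<^sub>m (dim_row A)" "B * A = 1\<^sub>m (dim_row B)"
    by (auto simp: invertible_mat_def inverts_mat_def)
  have "dim_col B = n" "dim_row B = n"
    using arg_cong[OF B(1), of dim_col] arg_cong[OF B(2), of dim_col] A by simp_all
  then have "B \<in> carrier_mat n n" by (rule_tac carrier_matI)
  then have "det A * det B = 1" using B(1) A det_mult[of A n B] by simp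
  then show "det A \<noteq> 0" by auto
next
  assume "det A \<noteq> 0"
  with A obtain B where "B \<in> carrier_mat n n" "A * B = 1\<^sub>m n" "B * A = 1\<^sub>m n"
    by (rule det_nonzero_obtain_inverse)
  then show "invertible_mat A"
    using A by (auto simp: invertible_mat_def inverts_mat_def)
qed

text \<open>Canonical forms put the adjoint factor on the left, bundles put it on the right. The
  bridge is \<open>P = adj Y\<close> for the inverse \<open>Y\<close> of \<open>X\<close>.\<close>

lemma (in involution) obtain_congruence_inverse:
  assumes A: "A \<in> carrier_mat n n" and X: "X \<in> carrier_mat n n" and d: "det X \<noteq> 0"
  obtains P where "P \<in> carrier_mat n n" "det P \<noteq> 0" "A = P * (adj X * A * X) * adj P"
proof -
  obtain Y where Y: "Y \<in> carrier_mat n n" "X * Y = 1\<^sub>m n" "Y * X = 1\<^sub>m n"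
    using det_nonzero_obtain_inverse[OF X d] by blast
  note c = A X Y(1) adj_carrier[OF X] adj_carrier[OF Y(1)]
  have e: "adj Y * adj X = 1\<^sub>m n"
    using adj_mult[OF X Y(1)] Y(2) adj_one by metis
  have "adj Y * (adj X * A * X) * Y = adj Y * (adj X * (A * X)) * Y"
    by (simp only: assoc_mult_mat[OF c(4,1,2)])
  also have "adj Y * (adj X * (A * X)) = adj Y * adj X * (A * X)"
    by (rule assoc_mult_mat[OF c(5,4) mult_carrier_mat[OF A X], symmetric])
  also have "\<dots> = A * X" unfolding e using A X by (intro left_mult_one_mat) auto
  also have "A * X * Y = A * (X * Y)" by (rule assoc_mult_mat[OF c(1,2,3)])
  also have "\<dots> = A" unfolding Y(2) by (rule right_mult_one_mat[OF A])
  finally have "A = adj Y * (adj X * A * X) * adj (adj Y)" by simp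
  moreover have "det Y \<noteq> 0" using det_mult[OF X Y(1)] Y(2) by auto
  then have "det (adj Y) \<noteq> 0" using det_adj[OF Y(1)] by simp
  ultimately show ?thesis using that[OF c(5)] by blast
qed

section \<open>Bundles of matrices with simple pencil roots\<close>

interpretation bil: involution id
  by unfold_locales simp_all

interpretation ses: involution cnj
  by unfold_locales simp_all

lemma bil_adj: "bil.adj A = transpose_mat A"
  by (rule eq_matI) auto

lemma ses_adj: "ses.adj A = mat_adjoint A"
  by (rule eq_matI) (auto simp: mat_adjoint_def mat_of_rows_index)

lemma dim_simple_form [simp]:
  "dim_row (simple_form cs rs) = length cs + 2 * length rs"
  "dim_col (simple_form cs rs) = length cs + 2 * length rs"
  by (simp_all add: simple_form_def dim_diag_block_mat comp_def scalar_block_def H_block_def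
      sum_list_triv)

lemma Gamma_block_1: "c \<cdot>\<^sub>m Gamma_block 1 = scalar_block c"
  by (rule eq_matI) (auto simp: Gamma_block_def scalar_block_def)

lemma Gamma_block_1': "Gamma_block 1 = scalar_block 1"
  by (rule eq_matI) (auto simp: Gamma_block_def scalar_block_def)

lemma map2_replicate: "map2 f (replicate (length xs) a) xs = map (f a) xs"
  by (induction xs) auto

lemma CFC_mat_simple:
  "CFC_mat [] (replicate k 1) (replicate (length rs) 1) rs [] = simple_form (replicate k 1) rs"
  unfolding CFC_mat_def simple_form_def map2_replicate by (simp add: Gamma_block_1'[simplified])

lemma star_CFC_mat_simple:
  "star_CFC_mat [] (replicate (length cs) 1) cs (replicate (length rs) 1) rs = simple_form cs rs"
  unfolding star_CFC_mat_def simple_form_def map2_replicate by (simp add: Gamma_block_1[simplified])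

lemma typeIIa_iff: "typeIIa r \<longleftrightarrow> cmod r > 1 \<or> cmod r = 1 \<and> Im r > 0"
proof -
  have "(\<exists>\<theta>. 0 < \<theta> \<and> \<theta> < pi \<and> r = exp (\<i> * of_real \<theta>)) \<longleftrightarrow> cmod r = 1 \<and> Im r > 0"
  proof
    assume "\<exists>\<theta>. 0 < \<theta> \<and> \<theta> < pi \<and> r = exp (\<i> * of_real \<theta>)"
    then show "cmod r = 1 \<and> Im r > 0" by (auto simp: Im_exp sin_gt_zero)
  next
    assume r: "cmod r = 1 \<and> Im r > 0"
    then have "r \<noteq> 0" by auto
    then have c: "r = cis (Arg r)" and b: "- pi < Arg r" "Arg r \<le> pi"
      using cis_Arg[of r] Arg_bounded[of r] r by (simp_all add: sgn_div_norm)
    have "sin (Arg r) > 0" using r c by (metis cis.sel(2))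
    then have "0 < Arg r \<and> Arg r < pi"
      using b sin_ge_zero[of "- Arg r"] by (cases "Arg r = pi") fastforce+
    moreover have "r = exp (\<i> * of_real (Arg r))" using c by (simp add: cis_conv_exp)
    ultimately show "\<exists>\<theta>. 0 < \<theta> \<and> \<theta> < pi \<and> r = exp (\<i> * of_real \<theta>)" by blast
  qed
  then show ?thesis by (simp add: typeIIa_def)
qed

text \<open>Off the unit circle inversion swaps inside and outside. On it inversion is conjugation,
  which swaps the open upper and lower halves and leaves only the excluded points 1 and -1
  fixed.\<close>

lemma selector_typeIIa: "bil.selector typeIIa"
  unfolding bil.selector_def
proof (intro allI impI)
  fix r :: complex assume "r \<noteq> 0" "r * id r \<noteq> 1"
  then have r: "r \<noteq> 0" "r * r \<noteq> 1" by simp_all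
  consider "cmod r > 1" | "cmod r < 1" | "cmod r = 1" by linarith
  then show "typeIIa r \<noteq> typeIIa (inverse (id r))"
  proof cases
    case 3
    have i: "inverse r = cnj r" using 3 r(1) by (simp add: inverse_unique complex_norm_square[symmetric])
    have "Im r \<noteq> 0"
    proof
      assume "Im r = 0"
      then have "cnj r = r" by (simp add: complex_eq_iff)
      then show False using i r by (metis right_inverse)
    qed
    then show ?thesis using 3 i by (auto simp: typeIIa_iff)
  qed (use r in \<open>auto simp: typeIIa_iff norm_inverse one_less_inverse_iff\<close>)
qed

lemma selector_norm: "ses.selector (\<lambda>r. cmod r > 1)"
  unfolding ses.selector_def
proof (intro allI impI)
  fix r :: complex assume r: "r \<noteq> 0" "r * cnj r \<noteq> 1"
  then have "cmod r \<noteq> 1" by (auto simp: complex_norm_square[symmetric])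
  then show "(cmod r > 1) \<noteq> (cmod (inverse (cnj r)) > 1)"
    using r by (auto simp: norm_inverse one_less_inverse_iff)
qed

text \<open>For the identity involution the last clause of \<open>generic_normal_form\<close> fails
  for any two scalar blocks by commutativity. So there is at most one, and the parity of
  \<open>n\<close> decides whether it occurs.\<close>

lemma bil_normal_form:
  assumes g: "bil.generic n A"
  obtains X rs where "X \<in> carrier_mat n n" "det X \<noteq> 0"
    "transpose_mat X * A * X = simple_form (replicate (n mod 2) 1) rs"
    "distinct rs" "\<forall>r\<in>set rs. typeIIa r" "length rs = n div 2"
proof -
  \<comment> \<open>Every nonzero complex number has a square root, so the value on a fixed root can
    be scaled to 1.\<close>
  have "\<exists>s. s \<noteq> 0 \<and> id s * s * c = 1" if "c \<noteq> 0" for c :: complex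
    using that by (intro exI[of _ "inverse (csqrt c)"]) (simp add: field_simps flip: power2_eq_square)
  then obtain X cs rs where X: "X \<in> carrier_mat n n" "det X \<noteq> 0" "bil.adj X * A * X = simple_form cs rs"
    and cs: "\<forall>c\<in>set cs. c = 1" and rs: "distinct rs" "\<forall>r\<in>set rs. typeIIa r"
    and len: "length cs + 2 * length rs = n"
    and "length cs = card {r \<in> bil.pencil_roots A. r * id r = 1}"
    and d: "\<forall>i<length cs. \<forall>j<length cs. i \<noteq> j \<longrightarrow> cs ! i * id (cs ! j) \<noteq> cs ! j * id (cs ! i)"
    by (rule bil.generic_normal_form[OF selector_typeIIa g, where N = "\<lambda>c. c = 1"])
  have "\<not> 1 < length cs"
  proof
    assume "1 < length cs"
    then have "cs ! 0 * id (cs ! 1) \<noteq> cs ! 1 * id (cs ! 0)" by (intro d[rule_format]) auto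
    then show False by (simp add: mult.commute)
  qed
  then have "length cs = n mod 2" "length rs = n div 2" using len by presburger+
  moreover have "cs = replicate (length cs) 1" using cs by (metis replicate_eqI)
  ultimately show ?thesis using that X rs by (metis bil_adj)
qed

text \<open>Both matrices reduce to the same shape with \<open>n div 2\<close> pairwise different
  parameters, so the form of \<open>A\<close> arises from that of \<open>D\<close> by an admissible
  change of parameters.\<close>

lemma bil_generic_bundle:
  assumes D: "bil.generic n D" and g: "bil.generic n A"
  shows "A \<in> congruence_bundle D"
proof -
  obtain X0 rs0 where X0: "X0 \<in> carrier_mat n n" "det X0 \<noteq> 0"
    "transpose_mat X0 * D * X0 = simple_form (replicate (n mod 2) 1) rs0"
    "distinct rs0" "\<forall>r\<in>set rs0. typeIIa r" "length rs0 = n div 2" using bil_normal_form[OF D] by blast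
  obtain X rs where X: "X \<in> carrier_mat n n" "det X \<noteq> 0"
    "transpose_mat X * A * X = simple_form (replicate (n mod 2) 1) rs"
    "distinct rs" "\<forall>r\<in>set rs. typeIIa r" "length rs = n div 2" using bil_normal_form[OF g] by blast
  have A: "A \<in> carrier_mat n n" and Dc: "D \<in> carrier_mat n n"
    using g D by (simp_all add: bil.generic_def)
  have cfc: "is_CFC D [] (replicate (n mod 2) 1) (replicate (length rs0) 1) rs0 []"
    using X0 Dc unfolding is_CFC_def CFC_mat_simple congruent_mat_def
    by (auto simp: invertible_mat_iff_det_nonzero[OF X0(1)] intro!: bexI[of _ X0])
  obtain P where P: "P \<in> carrier_mat n n" "det P \<noteq> 0"
    "A = P * simple_form (replicate (n mod 2) 1) rs * transpose_mat P"
    using bil.obtain_congruence_inverse[OF A X(1,2)] unfolding bil_adj X(3) by blast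
  have "A = P * CFC_mat [] (replicate (n mod 2) 1) (replicate (length rs0) 1) rs [] * transpose_mat P"
    using P(3) CFC_mat_simple[of "n mod 2" rs] X(6) X0(6) by simp
  moreover have "\<forall>i<length rs0. \<forall>j<length rs0. (rs ! i \<noteq> rs ! j) = (rs0 ! i \<noteq> rs0 ! j)"
    using X(4,6) X0(4,6) by (simp add: nth_eq_iff_index_eq)
  moreover have "P \<in> carrier_mat (dim_row D) (dim_row D)" "invertible_mat P"
    using P Dc invertible_mat_iff_det_nonzero[OF P(1)] by simp_all
  moreover have "length rs = length rs0" using X(6) X0(6) by simp
  ultimately show ?thesis
    unfolding congruence_bundle_def using cfc X(5) by blast
qed

lemma mult_cnj_eq_1_iff: "r * cnj r = 1 \<longleftrightarrow> cmod r = 1"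
proof -
  have "r * cnj r = of_real ((cmod r)\<^sup>2)" by (rule complex_norm_square[symmetric])
  then have "r * cnj r = 1 \<longleftrightarrow> (cmod r)\<^sup>2 = 1" by (metis of_real_eq_1_iff)
  then show ?thesis by (simp add: power2_eq_1_iff) (use norm_ge_zero[of r] in linarith)
qed

lemma ses_normal_form:
  assumes g: "ses.generic n A"
  obtains X cs rs where "X \<in> carrier_mat n n" "det X \<noteq> 0"
    "mat_adjoint X * A * X = simple_form cs rs"
    "\<forall>c\<in>set cs. cmod c = 1" "distinct (map (\<lambda>c. c\<^sup>2) cs)"
    "distinct rs" "\<forall>r\<in>set rs. cmod r > 1" "length cs + 2 * length rs = n"
    "length cs = card {r \<in> ses.pencil_roots A. cmod r = 1}"
proof -
  have "\<exists>s. s \<noteq> 0 \<and> cmod (cnj s * s * c) = 1" if "c \<noteq> 0" for c :: complex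
  proof (intro exI conjI)
    let ?s = "complex_of_real (inverse (sqrt (cmod c)))"
    show "?s \<noteq> 0" using that by simp
    show "cmod (cnj ?s * ?s * c) = 1" using that by (simp add: norm_mult field_simps norm_inverse norm_divide)
  qed
  then obtain X cs rs where X: "X \<in> carrier_mat n n" "det X \<noteq> 0" "ses.adj X * A * X = simple_form cs rs"
    and cs: "\<forall>c\<in>set cs. cmod c = 1" and rs: "distinct rs" "\<forall>r\<in>set rs. cmod r > 1"
    and len: "length cs + 2 * length rs = n" "length cs = card {r \<in> ses.pencil_roots A. r * cnj r = 1}"
    and d: "\<forall>i<length cs. \<forall>j<length cs. i \<noteq> j \<longrightarrow> cs ! i * cnj (cs ! j) \<noteq> cs ! j * cnj (cs ! i)"
    by (rule ses.generic_normal_form[OF selector_norm g, where N = "\<lambda>c. cmod c = 1"])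
  have "(cs ! i)\<^sup>2 \<noteq> (cs ! j)\<^sup>2" if ij: "i < length cs" "j < length cs" "i \<noteq> j" for i j
  proof
    assume "(cs ! i)\<^sup>2 = (cs ! j)\<^sup>2"
    then have "cs ! i = cs ! j \<or> cs ! i = - cs ! j" by (simp add: power2_eq_iff)
    then show False using d[rule_format, OF ij] by (auto simp: mult.commute)
  qed
  then have dist: "distinct (map (\<lambda>c. c\<^sup>2) cs)" by (simp add: distinct_conv_nth)
  show ?thesis
    by (rule that[OF X(1,2) X(3)[unfolded ses_adj] cs dist rs len(1) len(2)[unfolded mult_cnj_eq_1_iff]])
qed

text \<open>The number of roots on the unit circle determines \<open>length cs\<close> and hence
  \<open>length rs\<close>, so equal counts give normal forms of the same shape.\<close>

lemma ses_generic_bundle: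
  assumes D: "ses.generic n D" and g: "ses.generic n A"
    and card: "card {r \<in> ses.pencil_roots A. cmod r = 1} = card {r \<in> ses.pencil_roots D. cmod r = 1}"
  shows "A \<in> star_congruence_bundle D"
proof -
  obtain X0 cs0 rs0 where X0: "X0 \<in> carrier_mat n n" "det X0 \<noteq> 0"
    "mat_adjoint X0 * D * X0 = simple_form cs0 rs0"
    "\<forall>c\<in>set cs0. cmod c = 1" "distinct (map (\<lambda>c. c\<^sup>2) cs0)"
    "distinct rs0" "\<forall>r\<in>set rs0. cmod r > 1" "length cs0 + 2 * length rs0 = n"
    "length cs0 = card {r \<in> ses.pencil_roots D. cmod r = 1}" using ses_normal_form[OF D] .
  obtain X cs rs where X: "X \<in> carrier_mat n n" "det X \<noteq> 0"
    "mat_adjoint X * A * X = simple_form cs rs"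
    "\<forall>c\<in>set cs. cmod c = 1" "distinct (map (\<lambda>c. c\<^sup>2) cs)"
    "distinct rs" "\<forall>r\<in>set rs. cmod r > 1" "length cs + 2 * length rs = n"
    "length cs = card {r \<in> ses.pencil_roots A. cmod r = 1}" using ses_normal_form[OF g] .
  have A: "A \<in> carrier_mat n n" and Dc: "D \<in> carrier_mat n n"
    using g D by (simp_all add: ses.generic_def)
  have lc: "length cs = length cs0" and lr: "length rs = length rs0" using X X0 card by simp_all
  have cfc: "is_star_CFC D [] (replicate (length cs0) 1) cs0 (replicate (length rs0) 1) rs0"
    using X0 Dc unfolding is_star_CFC_def star_CFC_mat_simple star_congruent_mat_def
    by (auto simp: invertible_mat_iff_det_nonzero[OF X0(1)] intro!: bexI[of _ X0])
  obtain P where P: "P \<in> carrier_mat n n" "det P \<noteq> 0"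
    "A = P * simple_form cs rs * mat_adjoint P"
    using ses.obtain_congruence_inverse[OF A X(1,2)] unfolding ses_adj X(3) by blast
  have "A = P * star_CFC_mat [] (replicate (length cs0) 1) cs (replicate (length rs0) 1) rs * mat_adjoint P"
    using P(3) star_CFC_mat_simple[of cs rs] lc lr by simp
  moreover have "\<forall>i<length rs0. \<forall>j<length rs0. (rs ! i \<noteq> rs ! j) = (rs0 ! i \<noteq> rs0 ! j)"
    using X(6) X0(6) lr by (simp add: nth_eq_iff_index_eq)
  moreover have "((cs ! i)\<^sup>2 \<noteq> (cs ! j)\<^sup>2) = ((cs0 ! i)\<^sup>2 \<noteq> (cs0 ! j)\<^sup>2)"
    if "i < length cs0" "j < length cs0" for i j
    using lc that nth_eq_iff_index_eq[OF X(5), of i j] nth_eq_iff_index_eq[OF X0(5), of i j]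
    by simp
  \<comment> \<open>All Type I indices are 1, so the clause for indices of different parity holds
    vacuously.\<close>
  then have "\<forall>i < length (replicate (length cs0) (1::nat)). \<forall>j < length (replicate (length cs0) (1::nat)).
      (replicate (length cs0) (1::nat) ! i mod 2 = replicate (length cs0) (1::nat) ! j mod 2 \<longrightarrow>
        ((cs ! i)\<^sup>2 \<noteq> (cs ! j)\<^sup>2) = ((cs0 ! i)\<^sup>2 \<noteq> (cs0 ! j)\<^sup>2)) \<and>
      (replicate (length cs0) (1::nat) ! i mod 2 \<noteq> replicate (length cs0) (1::nat) ! j mod 2 \<longrightarrow>
        ((cs ! i)\<^sup>2 \<noteq> - (cs ! j)\<^sup>2) = ((cs0 ! i)\<^sup>2 \<noteq> - (cs0 ! j)\<^sup>2))"
    by simp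
  moreover have "P \<in> carrier_mat (dim_row D) (dim_row D)" "invertible_mat P"
    using P Dc invertible_mat_iff_det_nonzero[OF P(1)] by simp_all
  ultimately show ?thesis
    unfolding star_congruence_bundle_def using cfc X(4,7) lc lr by blast
qed

section \<open>Genericity of explicit block sums\<close>

lemma bil_generic_blocks:
  assumes mu: "\<forall>r\<in>set rs. typeIIa r" "distinct rs" and n: "n = k + 2 * length rs" "k \<le> 1"
    and Bs: "set Bs = set (map scalar_block (replicate k 1) @ map (H_block 1) rs)"
    and c: "diag_block_mat Bs \<in> carrier_mat n n"
  shows "bil.generic n (diag_block_mat Bs)"
proof (rule bil.generic_diag_block(1)[OF Bs _ _ refl _ _ c])
  \<comment> \<open>Type II-(a) parameters avoid 1 and -1, the fixed points of inversion. So each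
    gives two different roots, neither of which is the root 1 of the scalar block.\<close>
  have r: "r \<noteq> 0 \<and> r * r \<noteq> 1 \<and> typeIIa r" if "r \<in> set rs" for r
  proof -
    have t: "typeIIa r" using that mu by simp
    then have "r \<noteq> 0" by (auto simp: typeIIa_iff)
    moreover have "r * r \<noteq> 1"
    proof
      assume "r * r = 1"
      then have "r = 1 \<or> r = - 1" by (simp add: square_eq_1_iff)
      then show False using t by (auto simp: typeIIa_iff)
    qed
    ultimately show ?thesis using t by simp
  qed
  then show "0 \<notin> set rs" by blast
  show "0 \<notin> set (replicate k (1 :: complex))" by simp
  show "distinct (map (\<lambda>c. c / id c) (replicate k (1 :: complex)) @ concat (map (\<lambda>r. [r, inverse (id r)]) rs))"
    using n(2) r by (intro bil.distinct_root_list[OF selector_typeIIa _ _ mu(2)]) (auto simp: le_Suc_eq)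
  have "length (concat (map (\<lambda>r. [r, inverse (id r)]) rs)) = 2 * length rs" by (induction rs) auto
  then show "length (map (\<lambda>c. c / id c) (replicate k (1 :: complex)) @ concat (map (\<lambda>r. [r, inverse (id r)]) rs)) = n"
    using n by simp
qed

text \<open>The left side is the pencil root of \<open>scalar_block c\<close>. This is why the
  bundles compare the parameters of equal parity through their squares.\<close>

lemma div_cnj: "cmod c = 1 \<Longrightarrow> c / cnj c = c\<^sup>2"
proof -
  assume "cmod c = 1"
  then have "c * cnj c = 1" by (simp add: mult_cnj_eq_1_iff)
  then show ?thesis by (metis inverse_unique divide_inverse mult.commute power2_eq_square inverse_inverse_eq)
qed

lemma ses_generic_blocks:
  assumes cs: "\<forall>c\<in>set cs. cmod c = 1" "distinct (map (\<lambda>c. c\<^sup>2) cs)"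
    and rs: "\<forall>r\<in>set rs. cmod r > 1" "distinct rs" and n: "length cs + 2 * length rs = n"
    and Bs: "set Bs = set (map scalar_block cs @ map (H_block 1) rs)"
    and c: "diag_block_mat Bs \<in> carrier_mat n n"
  shows "ses.generic n (diag_block_mat Bs)"
    "card {r \<in> ses.pencil_roots (diag_block_mat Bs). cmod r = 1} = length cs"
proof -
  define ws where "ws = map (\<lambda>c. c / cnj c) cs @ concat (map (\<lambda>r. [r, inverse (cnj r)]) rs)"
  have sq: "map (\<lambda>c. c / cnj c) cs = map (\<lambda>c. c\<^sup>2) cs" using cs(1) by (simp add: div_cnj)
  have d: "distinct ws"
    unfolding ws_def sq using cs rs
    by (intro ses.distinct_root_list[OF selector_norm]) (auto simp: mult_cnj_eq_1_iff norm_power)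
  have "length (concat (map (\<lambda>r. [r, inverse (cnj r)]) rs)) = 2 * length rs" by (induction rs) auto
  then have len: "length ws = n" using n by (simp add: ws_def)
  have nz: "0 \<notin> set cs" "0 \<notin> set rs" using cs rs by force+
  note g = ses.generic_diag_block[OF Bs nz ws_def d len c]
  show "ses.generic n (diag_block_mat Bs)" by (rule g(1))
  have "{r \<in> set ws. cmod r = 1} = set (map (\<lambda>c. c\<^sup>2) cs)"
    unfolding ws_def sq using cs rs by (force simp: norm_power norm_inverse)
  then show "card {r \<in> ses.pencil_roots (diag_block_mat Bs). cmod r = 1} = length cs"
    unfolding g(2) using distinct_card[OF cs(2)] by simp
qed

text \<open>After reversal of the rows all diagonal entries vanish at the same \<open>z\<close>. Its
  sign depends on the parity of \<open>k\<close>, which explains why bundles compare a square with a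
  negated square when the indices differ in parity.\<close>

lemma pencil_roots_Gamma_block:
  assumes a: "cmod a = 1"
  shows "ses.pencil_roots (a \<cdot>\<^sub>m Gamma_block k) \<subseteq> {(- 1) ^ (k - 1) * a\<^sup>2}"
proof
  fix z assume z: "z \<in> ses.pencil_roots (a \<cdot>\<^sub>m Gamma_block k)"
  define M where "M = ses.pencil (a \<cdot>\<^sub>m Gamma_block k) z"
  \<comment> \<open>Multiplication by the exchange matrix \<open>E\<close> makes the pencil upper triangular.\<close>
  define E where "E = mat k k (\<lambda>(i, j). if i + j + 1 = k then 1 else 0 :: complex)"
  have G: "a \<cdot>\<^sub>m Gamma_block k \<in> carrier_mat k k" by (simp add: Gamma_block_def)
  have M: "M \<in> carrier_mat k k" unfolding M_def by (rule ses.pencil_carrier[OF G])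
  have E: "E \<in> carrier_mat k k" by (simp add: E_def)
  have M_index: "M $$ (i, j) = a * Gamma_block k $$ (i, j) - z * (cnj a * cnj (Gamma_block k $$ (j, i)))"
    if "i < k" "j < k" for i j
    using that by (simp add: M_def ses.pencil_def Gamma_block_def)
  have EM: "(E * M) $$ (i, j) = M $$ (k - 1 - i, j)" if ij: "i < k" "j < k" for i j
  proof -
    have "(E * M) $$ (i, j) = (\<Sum>m<k. (if i + m + 1 = k then 1 else 0) * M $$ (m, j))"
      using E M ij by (simp add: scalar_prod_def E_def atLeast0LessThan)
    also have "\<dots> = (\<Sum>m<k. if m = k - 1 - i then M $$ (m, j) else 0)"
      using ij by (intro sum.cong) auto
    finally show ?thesis using ij by simp
  qed
  have "upper_triangular (E * M)"
    unfolding upper_triangular_def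
  proof (intro allI impI)
    fix i j assume "i < dim_row (E * M)" "j < i"
    then have ij: "i < k" "j < k" "j < i" using E by auto
    then have "k - 1 - i + j + 1 \<noteq> k" "k - 1 - i + j \<noteq> k" "j + (k - 1 - i) + 1 \<noteq> k" "j + (k - 1 - i) \<noteq> k"
      by linarith+
    then have "Gamma_block k $$ (k - 1 - i, j) = 0" "Gamma_block k $$ (j, k - 1 - i) = 0"
      using ij unfolding Gamma_block_def by (subst index_mat, simp, simp, simp only: prod.case if_False simp_thms)+
    then show "(E * M) $$ (i, j) = 0" using ij by (simp add: EM M_index)
  qed
  moreover have "det (E * M) = 0" using z det_mult[OF E M] by (simp add: ses.pencil_roots_def M_def)
  ultimately obtain i where i: "i < k" "(E * M) $$ (i, i) = 0"
    using upper_triangular_imp_det_eq_0_iff[OF mult_carrier_mat[OF E M]] E M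
    by (auto simp: diag_mat_def)
  have e: "a * (- 1) ^ i = z * (cnj a * (- 1) ^ (k - Suc i))"
    using i(2) unfolding EM[OF i(1,1)] using i(1) by (simp add: M_index Gamma_block_def)
  have s: "(- 1 :: complex) ^ (k - Suc i) * (- 1) ^ (k - Suc i) = 1"
    by (simp flip: power_mult_distrib)
  have "a * cnj a = 1" using a by (simp add: mult_cnj_eq_1_iff)
  have "z = z * (a * cnj a) * ((- 1) ^ (k - Suc i) * (- 1) ^ (k - Suc i))"
    using s \<open>a * cnj a = 1\<close> by simp
  also have "\<dots> = (a * (- 1) ^ i) * (a * (- 1) ^ (k - Suc i))" unfolding e by (simp only: mult_ac)
  also have "\<dots> = (- 1) ^ (i + (k - Suc i)) * a\<^sup>2" by (simp only: power_add power2_eq_square mult_ac)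
  finally show "z \<in> {(- 1) ^ (k - 1) * a\<^sup>2}" using i(1) by simp
qed

section \<open>Root counts of canonical forms\<close>

lemma sum_list_ge_length: "\<forall>x\<in>set xs. x \<ge> (1::nat) \<Longrightarrow> length xs \<le> sum_list xs"
  by (induction xs) auto

lemma sum_list_eq_length: "\<forall>x\<in>set xs. x \<ge> (1::nat) \<Longrightarrow> sum_list xs = length xs \<Longrightarrow> xs = replicate (length xs) 1"
proof (induction xs)
  case (Cons x xs)
  have "length xs \<le> sum_list xs" using Cons.prems by (intro sum_list_ge_length) auto
  then have "x = 1" "sum_list xs = length xs" using Cons.prems by auto
  then show ?case using Cons by auto
qed simp

text \<open>Each block of size \<open>k\<close> (Types 0 and I) has at most one root, each block of size \<open>2 * k\<close> (Type II)
  at most two, so \<open>n\<close> distinct roots force all indices to be 1.\<close>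

lemma star_CFC_generic:
  assumes D: "ses.generic n D" and C: "is_star_CFC D ks ls \<alpha>s ms \<mu>s"
  shows "ks = []" "ls = replicate (length \<alpha>s) 1" "ms = replicate (length \<mu>s) 1"
    "distinct (map (\<lambda>c. c\<^sup>2) \<alpha>s)" "distinct \<mu>s" "length \<alpha>s + 2 * length \<mu>s = n"
    "length \<alpha>s = card {r \<in> ses.pencil_roots D. cmod r = 1}"
proof -
  have Dc: "D \<in> carrier_mat n n" and dD: "det D \<noteq> 0" and card: "card (ses.pencil_roots D) = n"
    using D by (simp_all add: ses.generic_def)
  have ge: "\<forall>k\<in>set ks. k \<ge> 1" "\<forall>l\<in>set ls. l \<ge> 1" "\<forall>m\<in>set ms. m \<ge> 1"
    and len: "length \<alpha>s = length ls" "length \<mu>s = length ms"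
    and al: "\<forall>\<alpha>\<in>set \<alpha>s. cmod \<alpha> = 1" and mu: "\<forall>\<mu>\<in>set \<mu>s. cmod \<mu> > 1"
    and sc: "star_congruent_mat D (star_CFC_mat ks ls \<alpha>s ms \<mu>s)"
    using C by (auto simp: is_star_CFC_def)
  define Bs where "Bs = map (\<lambda>k. jordan_block k 0) ks @ map2 (\<lambda>l \<alpha>. \<alpha> \<cdot>\<^sub>m Gamma_block l) ls \<alpha>s @ map2 H_block ms \<mu>s"
  obtain P where P: "P \<in> carrier_mat n n" "det P \<noteq> 0" and e: "diag_block_mat Bs = ses.adj P * D * P"
    using sc Dc by (auto simp: star_congruent_mat_def star_CFC_mat_def Bs_def ses_adj invertible_mat_iff_det_nonzero)
  have roots: "ses.pencil_roots (diag_block_mat Bs) = ses.pencil_roots D"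
    unfolding e by (rule ses.pencil_roots_cong[OF Dc P])
  have sq: "\<forall>B\<in>set Bs. square_mat B"
    by (auto simp: Bs_def Gamma_block_def H_block_def set_zip)
  have un: "ses.pencil_roots D = (\<Union>B\<in>set Bs. ses.pencil_roots B)"
    unfolding roots[symmetric] by (rule ses.pencil_roots_diag_block[OF sq])
  show ks: "ks = []"
  proof (rule ccontr)
    assume "ks \<noteq> []"
    then obtain k where k: "k \<in> set ks" by (cases ks) auto
    then have "k \<ge> 1" using ge by blast
    have "det (jordan_block k (0::complex)) = 0"
      by (subst det_upper_triangular[of _ k]) (use \<open>k \<ge> 1\<close> in \<open>auto simp: prod_list_diag_prod\<close>)
    then have "0 \<in> ses.pencil_roots (jordan_block k 0)"
      by (simp add: ses.pencil_roots_def ses.pencil_0[of _ k])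
    then have "0 \<in> ses.pencil_roots D" unfolding un using k by (auto simp: Bs_def)
    then show False using ses.pencil_roots_nonzero[OF Dc dD] by blast
  qed
  have "dim_row (diag_block_mat Bs) = n" unfolding e using P by simp
  moreover have "sum_list (map dim_row (map2 (\<lambda>l \<alpha>. \<alpha> \<cdot>\<^sub>m Gamma_block l) ls \<alpha>s)) = sum_list ls"
    using len(1) by (induction ls \<alpha>s rule: list_induct2') (auto simp: Gamma_block_def)
  moreover have "sum_list (map dim_row (map2 H_block ms \<mu>s)) = 2 * sum_list ms"
    using len(2) by (induction ms \<mu>s rule: list_induct2') (auto simp: H_block_def)
  ultimately have n: "n = sum_list ls + 2 * sum_list ms"
    by (simp add: dim_diag_block_mat Bs_def ks)
  \<comment> \<open>\<open>U\<close> collects the possible roots of Type I blocks, which lie on the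
    unit circle. Those of Type II blocks, collected in \<open>V\<close> below, lie off it, so the
    two kinds can be counted separately.\<close>
  define U where "U = (\<lambda>(l, \<alpha>). (- 1) ^ (l - 1) * \<alpha>\<^sup>2) ` set (zip ls \<alpha>s)"
  have cU: "card U \<le> length ls" unfolding U_def
    using card_length[of "zip ls \<alpha>s"] len by (intro le_trans[OF card_image_le]) auto
  have finU: "finite U" by (simp add: U_def)
  have sub: "ses.pencil_roots D \<subseteq> U \<union> set \<mu>s \<union> (\<lambda>\<mu>. inverse (cnj \<mu>)) ` set \<mu>s"
  proof
    fix z assume "z \<in> ses.pencil_roots D"
    then obtain B where B: "B \<in> set Bs" "z \<in> ses.pencil_roots B" unfolding un by blast
    from B(1) consider l \<alpha> where "(l, \<alpha>) \<in> set (zip ls \<alpha>s)" "B = \<alpha> \<cdot>\<^sub>m Gamma_block l"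
      | m \<mu> where "(m, \<mu>) \<in> set (zip ms \<mu>s)" "B = H_block m \<mu>"
      by (auto simp: Bs_def ks)
    then show "z \<in> U \<union> set \<mu>s \<union> (\<lambda>\<mu>. inverse (cnj \<mu>)) ` set \<mu>s"
    proof cases
      case 1
      then have "cmod \<alpha> = 1" using al set_zip_rightD by fast
      then have "z = (- 1) ^ (l - 1) * \<alpha>\<^sup>2"
        using B(2) pencil_roots_Gamma_block[of \<alpha> l] 1(2) by auto
      then show ?thesis using 1(1) by (force simp: U_def)
    next
      case 2
      have "\<mu> \<in> set \<mu>s" "m \<in> set ms" using 2 by (auto dest: set_zip_rightD set_zip_leftD)
      moreover from this have "\<mu> \<noteq> 0" "m > 0" using mu ge(3) by force+
      ultimately show ?thesis using B(2) 2(2) ses.pencil_roots_H_block[of \<mu> m] by auto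
    qed
  qed
  have nU: "cmod u = 1" if "u \<in> U" for u
    using that al by (auto simp: U_def norm_mult norm_power dest!: set_zip_rightD)
  define V where "V = set \<mu>s \<union> (\<lambda>\<mu>. inverse (cnj \<mu>)) ` set \<mu>s"
  have nV: "cmod v \<noteq> 1" if "v \<in> V" for v
    using that mu by (auto simp: V_def norm_inverse)
  have finV: "finite V" by (simp add: V_def)
  have cV: "card V \<le> 2 * card (set \<mu>s)" unfolding V_def
    using card_Un_le[of "set \<mu>s" "(\<lambda>\<mu>. inverse (cnj \<mu>)) ` set \<mu>s"]
      card_image_le[of "set \<mu>s" "\<lambda>\<mu>. inverse (cnj \<mu>)"] by simp
  have cmu: "card (set \<mu>s) \<le> length ms" using card_length[of \<mu>s] len by simp
  define F where "F = {r \<in> ses.pencil_roots D. cmod r = 1}"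
  have FU: "F \<subseteq> U" using sub nV unfolding F_def V_def by blast
  have OV: "ses.pencil_roots D - F \<subseteq> V" using sub nU unfolding F_def V_def by blast
  have finR: "finite (ses.pencil_roots D)" by (rule ses.finite_pencil_roots[OF Dc dD])
  have "card F + card (ses.pencil_roots D - F) = n"
    unfolding card[symmetric] using finR by (subst card_Diff_subset) (auto simp: F_def card_mono)
  moreover have "card F \<le> card U" by (rule card_mono[OF finU FU])
  moreover have "card (ses.pencil_roots D - F) \<le> card V" by (rule card_mono[OF finV OV])
  moreover have "length ls \<le> sum_list ls" "length ms \<le> sum_list ms"
    using ge by (auto intro: sum_list_ge_length)
  \<comment> \<open>\<open>n\<close> is at most \<open>card U + card V\<close>, this is at most
    \<open>length ls + 2 * length ms\<close>, and this is at most
    \<open>sum_list ls + 2 * sum_list ms\<close>, which is \<open>n\<close> again. Hence every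
    estimate used is an equality.\<close>
  ultimately have eqs: "sum_list ls = length ls" "sum_list ms = length ms" "card F = length ls"
      "card U = length ls" "card (set \<mu>s) = length ms"
    using n cU cV cmu by linarith+
  show ls: "ls = replicate (length \<alpha>s) 1" and "ms = replicate (length \<mu>s) 1"
    using sum_list_eq_length[OF ge(2)] sum_list_eq_length[OF ge(3)] eqs len by simp_all
  show "distinct \<mu>s" using eqs(5) len by (simp add: card_distinct)
  show "length \<alpha>s + 2 * length \<mu>s = n" using n eqs len by simp
  show "length \<alpha>s = card {r \<in> ses.pencil_roots D. cmod r = 1}" using eqs(3) len by (simp add: F_def)
  have "U \<subseteq> (\<lambda>c. c\<^sup>2) ` set \<alpha>s"
  proof
    fix u assume "u \<in> U"
    then obtain l a where la: "(l, a) \<in> set (zip ls \<alpha>s)" "u = (- 1) ^ (l - 1) * a\<^sup>2"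
      by (auto simp: U_def)
    then have "l \<in> set ls" "a \<in> set \<alpha>s" by (auto dest: set_zip_leftD set_zip_rightD)
    then have "l = 1" using ls by (metis in_set_replicate)
    then show "u \<in> (\<lambda>c. c\<^sup>2) ` set \<alpha>s" using la \<open>a \<in> set \<alpha>s\<close> by simp
  qed
  then have "card U \<le> card (set (map (\<lambda>c. c\<^sup>2) \<alpha>s))" by (intro card_mono) auto
  then have "card (set (map (\<lambda>c. c\<^sup>2) \<alpha>s)) = length (map (\<lambda>c. c\<^sup>2) \<alpha>s)"
    using eqs(4) len card_length[of "map (\<lambda>c. c\<^sup>2) \<alpha>s"] by simp
  then show "distinct (map (\<lambda>c. c\<^sup>2) \<alpha>s)" by (rule card_distinct)
qed

text \<open>A bundle may move the parameters but preserves which of them coincide. With all indices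
  equal to 1, as \<open>star_CFC_generic\<close> forces, the roots stay pairwise different, and the
  roots of Type I and Type II blocks stay on and off the unit circle respectively.\<close>

lemma star_bundle_generic:
  assumes D: "ses.generic n D" and A: "A \<in> star_congruence_bundle D"
  shows "ses.generic n A"
    "card {r \<in> ses.pencil_roots A. cmod r = 1} = card {r \<in> ses.pencil_roots D. cmod r = 1}"
proof -
  have Dc: "D \<in> carrier_mat n n" using D by (simp add: ses.generic_def)
  from A obtain P ks ls \<alpha>s \<alpha>s' ms \<mu>s \<mu>s' where
    A: "A = P * star_CFC_mat ks ls \<alpha>s' ms \<mu>s' * mat_adjoint P" and
    C: "is_star_CFC D ks ls \<alpha>s ms \<mu>s" and P0: "P \<in> carrier_mat (dim_row D) (dim_row D)" "invertible_mat P" and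
    al: "length \<alpha>s' = length \<alpha>s" "\<forall>\<alpha> \<in> set \<alpha>s'. cmod \<alpha> = 1" and
    mu: "length \<mu>s' = length \<mu>s" "\<forall>\<mu> \<in> set \<mu>s'. cmod \<mu> > 1" and
    alc: "\<forall>i < length ls. \<forall>j < length ls.
           (ls ! i mod 2 = ls ! j mod 2 \<longrightarrow>
              ((\<alpha>s' ! i)\<^sup>2 \<noteq> (\<alpha>s' ! j)\<^sup>2 \<longleftrightarrow> (\<alpha>s ! i)\<^sup>2 \<noteq> (\<alpha>s ! j)\<^sup>2))" and
    muc: "\<forall>i < length \<mu>s. \<forall>j < length \<mu>s. \<mu>s' ! i \<noteq> \<mu>s' ! j \<longleftrightarrow> \<mu>s ! i \<noteq> \<mu>s ! j"
    unfolding star_congruence_bundle_def by blast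
  note s = star_CFC_generic[OF D C]
  have P: "P \<in> carrier_mat n n" "det P \<noteq> 0"
    using P0 Dc invertible_mat_iff_det_nonzero[of P n] by auto
  define S where "S = simple_form \<alpha>s' \<mu>s'"
  have S': "star_CFC_mat ks ls \<alpha>s' ms \<mu>s' = S"
    unfolding S_def star_CFC_mat_simple[symmetric] s(1) al(1) mu(1) using s(2,3) by metis
  have Sc: "S \<in> carrier_mat n n" using s(6) al mu by (intro carrier_matI) (simp_all add: S_def)
  have "(\<alpha>s' ! i)\<^sup>2 \<noteq> (\<alpha>s' ! j)\<^sup>2" if ij: "i < length \<alpha>s'" "j < length \<alpha>s'" "i \<noteq> j" for i j
  proof -
    have "length ls = length \<alpha>s" "ls ! i = 1" "ls ! j = 1"
      using s(2) ij al(1) by (metis length_replicate, metis nth_replicate, metis nth_replicate)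
    moreover have "(\<alpha>s ! i)\<^sup>2 \<noteq> (\<alpha>s ! j)\<^sup>2"
      using s(4) ij al(1) by (simp add: distinct_conv_nth)
    ultimately show ?thesis using alc ij al(1) by simp
  qed
  then have da: "distinct (map (\<lambda>c. c\<^sup>2) \<alpha>s')" by (simp add: distinct_conv_nth)
  have dm: "distinct \<mu>s'" using s(5) muc mu(1) by (simp add: distinct_conv_nth)
  have len: "length \<alpha>s' + 2 * length \<mu>s' = n" using s(6) al mu by simp
  note gS = ses_generic_blocks[OF al(2) da mu(2) dm len refl Sc[unfolded S_def simple_form_def],
      folded simple_form_def, folded S_def]
  \<comment> \<open>Read as a *congruence by \<open>adj P\<close>, the product has the form required
    by \<open>pencil_roots_cong\<close>.\<close>
  have Ae: "A = ses.adj (ses.adj P) * S * ses.adj P"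
    unfolding A S' ses_adj[symmetric] by simp
  note aP = ses.adj_carrier[OF P(1)]
  have dP: "det (ses.adj P) \<noteq> 0" using ses.det_adj[OF P(1)] P(2) by simp
  have Sg: "det S \<noteq> 0" using gS(1) by (simp add: ses.generic_def)
  have roots: "ses.pencil_roots A = ses.pencil_roots S"
    unfolding Ae by (rule ses.pencil_roots_cong[OF Sc aP dP])
  have Ac: "A \<in> carrier_mat n n" unfolding Ae
    by (rule mult_carrier_mat[OF mult_carrier_mat[OF ses.adj_carrier[OF aP] Sc] aP])
  have "0 \<notin> ses.pencil_roots A" unfolding roots using ses.pencil_roots_nonzero[OF Sc Sg] by blast
  then have "det A \<noteq> 0" by (simp add: ses.pencil_roots_def ses.pencil_0[OF Ac])
  then show "ses.generic n A" using Ac gS(1) by (simp add: ses.generic_def roots)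
  show "card {r \<in> ses.pencil_roots A. cmod r = 1} = card {r \<in> ses.pencil_roots D. cmod r = 1}"
    unfolding roots using gS(2) al(1) s(7) by simp
qed

section \<open>Continuity of the pencil roots\<close>

lemma tendsto_det:
  fixes M :: "nat \<Rightarrow> complex mat"
  assumes M: "\<And>k. M k \<in> carrier_mat n n" and L: "L \<in> carrier_mat n n"
    and lim: "\<And>i j. i < n \<Longrightarrow> j < n \<Longrightarrow> (\<lambda>k. M k $$ (i, j)) \<longlonglongrightarrow> L $$ (i, j)"
  shows "(\<lambda>k. det (M k)) \<longlonglongrightarrow> det L"
  unfolding det_def'[OF M] det_def'[OF L]
  by (intro tendsto_sum tendsto_mult tendsto_const tendsto_prod lim) (auto simp: permutes_in_image)

text \<open>This makes the continuity of the roots quantitative: if the left side is small against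
  \<open>cmod (det A)\<close>, some factor is small, so some root lies close to
  \<open>w\<close>.\<close>

lemma pencil_roots_prod:
  assumes g: "ses.generic n A"
  shows "cmod (det (ses.pencil A w)) = cmod (det A) * (\<Prod>v\<in>ses.pencil_roots A. cmod (w - v))"
proof -
  have A: "A \<in> carrier_mat n n" and d: "det A \<noteq> 0" using g by (simp_all add: ses.generic_def)
  define p where "p = ses.pencil_poly A"
  have "rsquarefree p" using g ses.generic_iff_pencil_poly[OF A] by (simp add: p_def)
  then have dec: "Polynomial.smult (lead_coeff p) (\<Prod>z | poly p z = 0. [:- z, 1:]) = p"
    by (rule complex_poly_decompose_rsquarefree)
  have R: "{z. poly p z = 0} = ses.pencil_roots A"
    by (simp add: p_def ses.poly_pencil_poly[OF A] ses.pencil_roots_def)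
  have "poly p x = lead_coeff p * (\<Prod>v\<in>ses.pencil_roots A. x - v)" for x
    by (subst dec[symmetric]) (simp add: R poly_prod)
  then have f: "det (ses.pencil A x) = lead_coeff p * (\<Prod>v\<in>ses.pencil_roots A. x - v)" for x
    by (simp add: p_def ses.poly_pencil_poly[OF A])
  \<comment> \<open>The product of the roots is unimodular, as the roots are permuted by \<open>v \<mapsto> 1 / cnj v\<close>.\<close>
  define Q where "Q = (\<Prod>v\<in>ses.pencil_roots A. cmod v)"
  have nz: "v \<noteq> 0" if "v \<in> ses.pencil_roots A" for v using ses.pencil_roots_nonzero[OF A d that] .
  have "bij_betw (\<lambda>v. inverse (cnj v)) (ses.pencil_roots A) (ses.pencil_roots A)"
    by (rule bij_betwI[where g = "\<lambda>v. inverse (cnj v)"])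
      (use ses.pencil_roots_reciprocal[OF A d] in auto)
  then have "Q = (\<Prod>v\<in>ses.pencil_roots A. cmod (inverse (cnj v)))"
    unfolding Q_def by (rule prod.reindex_bij_betw[symmetric])
  also have "\<dots> = inverse Q"
    using prod_inversef[of cmod "ses.pencil_roots A"] by (simp add: Q_def norm_inverse comp_def)
  finally have "Q = inverse Q" .
  moreover have "Q > 0" unfolding Q_def using nz by (intro prod_pos) auto
  ultimately have "Q * Q = 1" by (metis less_irrefl right_inverse)
  then have "Q = 1" using \<open>Q > 0\<close> by (simp add: square_eq_1_iff)
  then have "cmod (det A) = cmod (lead_coeff p)"
    using f[of 0] by (simp add: ses.pencil_0[OF A] norm_mult prod_norm[symmetric] Q_def)
  then show ?thesis by (simp add: f norm_mult prod_norm[symmetric])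
qed

text \<open>For a suitable \<open>k\<close> the roots of \<open>A k\<close> are matched with those
  of \<open>B\<close> at distances below \<open>\<delta>\<close>, and the matching respects the unit
  circle in both directions.\<close>

lemma card_unit_roots_limit:
  fixes A :: "nat \<Rightarrow> complex mat"
  assumes gA: "\<And>k. ses.generic n (A k)" and gB: "ses.generic n B"
    and lim: "\<And>i j. i < n \<Longrightarrow> j < n \<Longrightarrow> (\<lambda>k. A k $$ (i, j)) \<longlonglongrightarrow> B $$ (i, j)"
  shows "\<exists>k. card {r \<in> ses.pencil_roots (A k). cmod r = 1} = card {r \<in> ses.pencil_roots B. cmod r = 1}"
proof -
  have Ac: "A k \<in> carrier_mat n n" and dA: "det (A k) \<noteq> 0"
    and cA: "card (ses.pencil_roots (A k)) = n" for k using gA[of k] by (simp_all add: ses.generic_def)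
  have Bc: "B \<in> carrier_mat n n" and dB: "det B \<noteq> 0" and cB: "card (ses.pencil_roots B) = n"
    using gB by (simp_all add: ses.generic_def)
  define R where "R = ses.pencil_roots B"
  have fR: "finite R" unfolding R_def by (rule ses.finite_pencil_roots[OF Bc dB])
  have fA: "finite (ses.pencil_roots (A k))" for k by (rule ses.finite_pencil_roots[OF Ac dA])
  \<comment> \<open>\<open>E\<close> lists the upper bounds for \<open>\<delta>\<close>: 1/2 keeps
    the partner of a unimodular root away from 0, the thirds of the mutual distances identify roots
    of \<open>B\<close> that are closer than \<open>3 * \<delta>\<close>, and the distances to the
    unit circle keep partners of the other roots off it.\<close>
  define E where "E = {1 / 2} \<union> (\<lambda>(w, w'). dist w w' / 3) ` (R \<times> R - Id)
    \<union> (\<lambda>w. \<bar>cmod w - 1\<bar>) ` {w \<in> R. cmod w \<noteq> 1}"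
  have fE: "finite E" using fR by (simp add: E_def)
  have posE: "x > 0" if "x \<in> E" for x using that by (auto simp: E_def)
  define \<delta> where "\<delta> = Min E"
  have neE: "E \<noteq> {}" by (simp add: E_def)
  have d0: "\<delta> > 0" unfolding \<delta>_def using Min_in[OF fE neE] posE by blast
  have dle: "\<delta> \<le> x" if "x \<in> E" for x unfolding \<delta>_def using fE that by (rule Min_le)
  have d1: "\<delta> \<le> 1 / 2" by (rule dle) (simp add: E_def)
  have d2: "3 * \<delta> \<le> dist w w'" if "w \<in> R" "w' \<in> R" "w \<noteq> w'" for w w'
  proof -
    have "dist w w' / 3 \<in> E" using that unfolding E_def by force
    then show ?thesis using dle by fastforce
  qed
  have d3: "\<delta> \<le> \<bar>cmod w - 1\<bar>" if "w \<in> R" "cmod w \<noteq> 1" for w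
    using that by (intro dle) (simp add: E_def)
  have limp: "(\<lambda>k. cmod (det (ses.pencil (A k) w)) / cmod (det (A k))) \<longlonglongrightarrow> 0" if w: "w \<in> R" for w
  proof -
    have "(\<lambda>k. det (ses.pencil (A k) w)) \<longlonglongrightarrow> det (ses.pencil B w)"
    proof (rule tendsto_det[OF ses.pencil_carrier[OF Ac] ses.pencil_carrier[OF Bc]])
      fix i j assume ij: "i < n" "j < n"
      have "(\<lambda>k. A k $$ (i, j) - w * cnj (A k $$ (j, i))) \<longlonglongrightarrow> B $$ (i, j) - w * cnj (B $$ (j, i))"
        by (intro tendsto_intros lim ij)
      then show "(\<lambda>k. ses.pencil (A k) w $$ (i, j)) \<longlonglongrightarrow> ses.pencil B w $$ (i, j)"
        using ij Bc Ac[THEN carrier_matD(1)] Ac[THEN carrier_matD(2)] by (simp add: ses.pencil_def)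
    qed
    moreover have "det (ses.pencil B w) = 0" using w by (simp add: R_def ses.pencil_roots_def)
    ultimately have "(\<lambda>k. cmod (det (ses.pencil (A k) w))) \<longlonglongrightarrow> 0"
      using tendsto_norm_zero by fastforce
    moreover have "(\<lambda>k. cmod (det (A k))) \<longlonglongrightarrow> cmod (det B)"
      by (intro tendsto_norm tendsto_det[OF Ac Bc] lim)
    ultimately have "(\<lambda>k. cmod (det (ses.pencil (A k) w)) / cmod (det (A k))) \<longlonglongrightarrow> 0 / cmod (det B)"
      using dB by (intro tendsto_divide) auto
    then show ?thesis by simp
  qed
  \<comment> \<open>\<open>\<delta> ^ n\<close> is a lower bound for the product of the distances
    from \<open>w\<close> to \<open>n\<close> roots if none of them is closer than
    \<open>\<delta>\<close>.\<close>
  have "eventually (\<lambda>k. \<forall>w\<in>R. cmod (det (ses.pencil (A k) w)) / cmod (det (A k)) < \<delta> ^ n) sequentially"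
    using fR d0 by (intro eventually_ball_finite ballI order_tendstoD(2)[OF limp]) auto
  then obtain k where k: "\<And>w. w \<in> R \<Longrightarrow> cmod (det (ses.pencil (A k) w)) / cmod (det (A k)) < \<delta> ^ n"
    by (auto simp: eventually_sequentially)
  define S where "S = ses.pencil_roots (A k)"
  have "\<exists>v\<in>S. dist w v < \<delta>" if w: "w \<in> R" for w
  proof (rule ccontr)
    assume "\<not> (\<exists>v\<in>S. dist w v < \<delta>)"
    then have "(\<Prod>v\<in>S. \<delta>) \<le> (\<Prod>v\<in>S. cmod (w - v))"
      using d0 by (intro prod_mono) (auto simp: dist_norm not_less)
    then show False
      using k[OF w] dA[of k] cA[of k] pencil_roots_prod[OF gA[of k], of w] by (simp add: S_def)
  qed
  then obtain v where v: "\<And>w. w \<in> R \<Longrightarrow> v w \<in> S \<and> dist w (v w) < \<delta>" by metis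
  have inj: "inj_on v R"
  proof (rule inj_onI, rule ccontr)
    fix w w' assume w: "w \<in> R" "w' \<in> R" "v w = v w'" "w \<noteq> w'"
    have "dist w w' \<le> dist w (v w) + dist w' (v w')"
      using w(3) by (metis dist_triangle2)
    then show False using v[OF w(1)] v[OF w(2)] d2[OF w(1,2,4)] d0 by simp
  qed
  \<comment> \<open>Both sets of roots have \<open>n\<close> elements, so the injective matching is
    onto. In particular the reflection of a matched root is itself matched.\<close>
  have im: "v ` R = S"
    using card_image[OF inj] cA[of k] cB fA[of k] v by (intro card_subset_eq) (auto simp: S_def R_def)
  have unit: "cmod (v w) = 1 \<longleftrightarrow> cmod w = 1" if w: "w \<in> R" for w
  proof
    assume 1: "cmod (v w) = 1"
    show "cmod w = 1"
    proof (rule ccontr)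
      assume "cmod w \<noteq> 1"
      then have "\<delta> \<le> \<bar>cmod w - cmod (v w)\<bar>" using d3[OF w] 1 by simp
      also have "\<dots> \<le> dist w (v w)" unfolding dist_norm by (rule norm_triangle_ineq3)
      finally show False using v[OF w] by simp
    qed
  next
    assume 1: "cmod w = 1"
    define u where "u = inverse (cnj (v w))"
    have "u \<in> S" unfolding u_def S_def
      by (rule ses.pencil_roots_reciprocal[OF Ac dA]) (use v[OF w] in \<open>simp add: S_def\<close>)
    then obtain w' where w': "w' \<in> R" "u = v w'" using im by blast
    have vw: "cmod (v w) \<ge> 1 / 2"
      using v[OF w] d1 norm_triangle_ineq2[of w "v w"] 1 by (simp add: dist_norm)
    have v0: "v w \<noteq> 0" using vw by auto
    have "w * cnj w = 1" using 1 by (simp add: mult_cnj_eq_1_iff)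
    \<comment> \<open>Reflection fixes \<open>w\<close>, so the reflection \<open>u\<close> of
      \<open>v w\<close> stays within \<open>2 * \<delta>\<close> of \<open>w\<close>. Then the root
      of \<open>B\<close> matched with \<open>u\<close> is closer to \<open>w\<close> than
      \<open>3 * \<delta>\<close>, hence equals \<open>w\<close>, and \<open>v w\<close> is its own
      reflection.\<close>
    then have "w - u = w * cnj (v w - w) * u"
      using v0 by (simp add: u_def field_simps)
    then have "dist w u = dist w (v w) * cmod u"
      using 1 by (simp add: dist_norm norm_mult norm_minus_commute flip: complex_cnj_diff)
    also have "\<dots> \<le> \<delta> * 2"
    proof (intro mult_mono)
      have "cmod u \<le> inverse (1 / 2)"
        unfolding u_def norm_inverse complex_mod_cnj by (rule le_imp_inverse_le[OF vw]) simp
      then show "cmod u \<le> 2" by simp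
    qed (use v[OF w] d0 in auto)
    finally have "dist w w' < 3 * \<delta>"
      using v[OF w'(1)] w'(2) dist_triangle2[of w w' u] by simp
    then have "w = w'" using d2[OF w w'(1)] by force
    then have "v w * cnj (v w) = 1" using w'(2) v0 by (simp add: u_def field_simps)
    then show "cmod (v w) = 1" by (simp add: mult_cnj_eq_1_iff)
  qed
  have "{r \<in> S. cmod r = 1} = v ` {r \<in> R. cmod r = 1}"
    unfolding im[symmetric] using unit by auto
  then have "card {r \<in> S. cmod r = 1} = card {r \<in> R. cmod r = 1}"
    using inj by (simp add: card_image inj_on_subset)
  then show ?thesis unfolding S_def R_def by blast
qed

section \<open>Closures and the representatives of the bundles\<close>

lemma mat_closure_subset: "mat_closure n W \<subseteq> carrier_mat n n"
  by (auto simp: mem_mat_closure_iff)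

lemma distinct_map_upt:
  assumes "\<forall>i\<in>{1..m}. \<forall>j\<in>{1..m}. i \<noteq> j \<longrightarrow> f i \<noteq> f j"
  shows "distinct (map f [1..<m + 1])"
proof -
  have "inj_on f {1..m}" unfolding inj_on_def using assms by blast
  moreover have "set [1..<m + 1] = {1..m}" by auto
  ultimately show ?thesis by (metis distinct_map distinct_upt)
qed

lemma bil_generic_representative:
  assumes "\<forall>i\<in>{1..n div 2}. typeIIa (\<mu> i)"
    and "\<forall>i\<in>{1..n div 2}. \<forall>i'\<in>{1..n div 2}. i \<noteq> i' \<longrightarrow> \<mu> i \<noteq> \<mu> i'"
  shows "bil.generic n (diag_block_mat
     (map (\<lambda>i. H_block 1 (\<mu> i)) [1..<n div 2 + 1] @ (if even n then [] else [scalar_block 1])))"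
proof (rule bil_generic_blocks[where rs = "map \<mu> [1..<n div 2 + 1]" and k = "n mod 2"])
  show "\<forall>r\<in>set (map \<mu> [1..<n div 2 + 1]). typeIIa r" using assms(1) by auto
  show "distinct (map \<mu> [1..<n div 2 + 1])"
    using distinct_map_upt[OF assms(2)] .
  show "n = n mod 2 + 2 * length (map \<mu> [1..<n div 2 + 1])" by simp
  show "set (map (\<lambda>i. H_block 1 (\<mu> i)) [1..<n div 2 + 1] @ (if even n then [] else [scalar_block 1])) =
      set (map scalar_block (replicate (n mod 2) 1) @ map (H_block 1) (map \<mu> [1..<n div 2 + 1]))"
    by (cases "even n") (auto simp: even_iff_mod_2_eq_zero odd_iff_mod_2_eq_one)
  show "diag_block_mat (map (\<lambda>i. H_block 1 (\<mu> i)) [1..<n div 2 + 1] @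
      (if even n then [] else [scalar_block 1])) \<in> carrier_mat n n"
    by (intro carrier_matI)
      (auto simp: dim_diag_block_mat comp_def H_block_def scalar_block_def sum_list_triv odd_iff_mod_2_eq_one,
        presburger+)
qed auto

lemma ses_generic_representative:
  assumes l: "l \<le> n div 2" and mu: "\<forall>i\<in>{1..l}. cmod (\<mu> i) > 1"
    "\<forall>i\<in>{1..l}. \<forall>i'\<in>{1..l}. i \<noteq> i' \<longrightarrow> \<mu> i \<noteq> \<mu> i'"
    and al: "\<forall>j\<in>{1..n - 2 * l}. cmod (\<alpha> j) = 1"
    "\<forall>j\<in>{1..n - 2 * l}. \<forall>j'\<in>{1..n - 2 * l}. j \<noteq> j' \<longrightarrow> (\<alpha> j)\<^sup>2 \<noteq> (\<alpha> j')\<^sup>2"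
  defines "D \<equiv> diag_block_mat (map (\<lambda>i. H_block 1 (\<mu> i)) [1..<l + 1] @
      map (\<lambda>j. scalar_block (\<alpha> j)) [1..<n - 2 * l + 1])"
  shows "ses.generic n D" "card {r \<in> ses.pencil_roots D. cmod r = 1} = n - 2 * l"
proof -
  define cs where "cs = map \<alpha> [1..<n - 2 * l + 1]"
  define rs where "rs = map \<mu> [1..<l + 1]"
  have cs: "\<forall>c\<in>set cs. cmod c = 1" "distinct (map (\<lambda>c. c\<^sup>2) cs)"
    using al(1) distinct_map_upt[OF al(2)] by (auto simp: cs_def comp_def)
  have rs: "\<forall>r\<in>set rs. cmod r > 1" "distinct rs"
    using mu(1) distinct_map_upt[OF mu(2)] by (auto simp: rs_def)
  have len: "length cs + 2 * length rs = n" using l by (simp add: cs_def rs_def) presburger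
  have c: "D \<in> carrier_mat n n" unfolding D_def using l
    by (intro carrier_matI)
      (simp_all add: dim_diag_block_mat comp_def H_block_def scalar_block_def sum_list_triv, linarith+)
  have s: "set (map (\<lambda>i. H_block 1 (\<mu> i)) [1..<l + 1] @ map (\<lambda>j. scalar_block (\<alpha> j)) [1..<n - 2 * l + 1])
    = set (map scalar_block cs @ map (H_block 1) rs)" by (auto simp: cs_def rs_def)
  have lc: "length cs = n - 2 * l" unfolding cs_def length_map length_upt by simp
  show "ses.generic n D" "card {r \<in> ses.pencil_roots D. cmod r = 1} = n - 2 * l"
    using ses_generic_blocks[OF cs rs len s c[unfolded D_def]] lc by (simp_all only: D_def)
qed


lemma mat_closure_eqI:
  assumes "\<And>A e. A \<in> carrier_mat n n \<Longrightarrow> e > 0 \<Longrightarrow>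
    \<exists>C\<in>W. C \<in> carrier_mat n n \<and> (\<forall>i<n. \<forall>j<n. cmod (C $$ (i, j) - A $$ (i, j)) < e)"
  shows "mat_closure n W = carrier_mat n n"
proof (intro equalityI subsetI)
  fix A :: "complex mat" assume A: "A \<in> carrier_mat n n"
  then show "A \<in> mat_closure n W"
    unfolding mem_mat_closure_iff using assms[OF A] by blast
qed (use mat_closure_subset in blast)

lemma mat_closure_UN:
  "finite L \<Longrightarrow> mat_closure n (\<Union>l\<in>L. G l) = (\<Union>l\<in>L. mat_closure n (G l))"
  unfolding mat_closure_def by (simp add: closure_of_Union)

lemma mat_closure_sequence:
  assumes "B \<in> mat_closure n W"
  obtains A where "\<And>k. A k \<in> W" "\<And>k. A k \<in> carrier_mat n n"
    "\<And>i j. i < n \<Longrightarrow> j < n \<Longrightarrow> (\<lambda>k. A k $$ (i, j)) \<longlonglongrightarrow> B $$ (i, j)"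
proof -
  have "\<forall>k. \<exists>C. C \<in> W \<and> C \<in> carrier_mat n n \<and>
      (\<forall>i<n. \<forall>j<n. cmod (C $$ (i, j) - B $$ (i, j)) < inverse (real (Suc k)))"
    using assms unfolding mem_mat_closure_iff
    by (metis IntE inverse_positive_iff_positive of_nat_0_less_iff zero_less_Suc)
  then obtain A where A: "\<And>k. A k \<in> W" "\<And>k. A k \<in> carrier_mat n n"
    "\<And>k i j. i < n \<Longrightarrow> j < n \<Longrightarrow> cmod (A k $$ (i, j) - B $$ (i, j)) < inverse (real (Suc k))"
    by metis
  have "(\<lambda>k. A k $$ (i, j)) \<longlonglongrightarrow> B $$ (i, j)" if "i < n" "j < n" for i j
  proof (rule LIM_zero_cancel, rule tendsto_norm_zero_cancel,
      rule tendsto_sandwich[OF _ _ tendsto_const LIMSEQ_inverse_real_of_nat])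
    show "\<forall>\<^sub>F k in sequentially. cmod (A k $$ (i, j) - B $$ (i, j)) \<le> inverse (real (Suc k))"
      by (intro always_eventually allI less_imp_le A(3)[OF that])
  qed auto
  with A show ?thesis using that by blast
qed

text \<open>Genericity of the representative serves twice: it supplies the second point of the lines
  in \<open>generic_dense\<close>, and it places every generic matrix in the bundle.\<close>

theorem mat_closure_generic_congruence_bundle:
  assumes "\<forall>i\<in>{1..n div 2}. typeIIa (\<mu> i)"
    and "\<forall>i\<in>{1..n div 2}. \<forall>i'\<in>{1..n div 2}. i \<noteq> i' \<longrightarrow> \<mu> i \<noteq> \<mu> i'"
  shows "carrier_mat n n = mat_closure n (generic_congruence_bundle n \<mu>)"
proof (rule mat_closure_eqI[symmetric])
  note D = bil_generic_representative[OF assms]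
  fix A :: "complex mat" and e :: real assume "A \<in> carrier_mat n n" "e > 0"
  then obtain C where C: "bil.generic n C" "\<forall>i<n. \<forall>j<n. cmod (C $$ (i, j) - A $$ (i, j)) < e"
    using bil.generic_dense[OF _ D] by blast
  then have "C \<in> generic_congruence_bundle n \<mu>"
    unfolding generic_congruence_bundle_def using bil_generic_bundle[OF D] by blast
  with C show "\<exists>C\<in>generic_congruence_bundle n \<mu>. C \<in> carrier_mat n n \<and>
      (\<forall>i<n. \<forall>j<n. cmod (C $$ (i, j) - A $$ (i, j)) < e)"
    by (auto simp: bil.generic_def)
qed

text \<open>The right side mentions neither \<open>\<mu>\<close> nor \<open>\<alpha>\<close>, so the
  bundle is independent of the chosen parameters and the closures can be studied through root counts
  alone.\<close>

lemma generic_star_congruence_bundle_iff: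
  assumes "l \<le> n div 2" and "\<forall>i\<in>{1..l}. cmod (\<mu> i) > 1"
    "\<forall>i\<in>{1..l}. \<forall>i'\<in>{1..l}. i \<noteq> i' \<longrightarrow> \<mu> i \<noteq> \<mu> i'"
    and "\<forall>j\<in>{1..n - 2 * l}. cmod (\<alpha> j) = 1"
    "\<forall>j\<in>{1..n - 2 * l}. \<forall>j'\<in>{1..n - 2 * l}. j \<noteq> j' \<longrightarrow> (\<alpha> j)\<^sup>2 \<noteq> (\<alpha> j')\<^sup>2"
  shows "A \<in> generic_star_congruence_bundle n l \<mu> \<alpha> \<longleftrightarrow>
    ses.generic n A \<and> card {r \<in> ses.pencil_roots A. cmod r = 1} = n - 2 * l"
proof -
  note D = ses_generic_representative[OF assms]
  show ?thesis
    unfolding generic_star_congruence_bundle_def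
    using star_bundle_generic[OF D(1), unfolded D(2)] ses_generic_bundle[OF D(1), unfolded D(2)]
    by blast
qed

text \<open>Roots off the unit circle come in pairs, so every generic matrix lies in some
  \<open>G l\<close>, and density gives the covering. A sequence in \<open>G l1\<close> with limit
  in \<open>G l2\<close> would contradict \<open>card_unit_roots_limit\<close>.\<close>

theorem mat_closure_generic_star_bundles:
  fixes G :: "nat \<Rightarrow> complex mat set"
  assumes G: "\<And>l A. l \<le> n div 2 \<Longrightarrow>
      A \<in> G l \<longleftrightarrow> ses.generic n A \<and> card {r \<in> ses.pencil_roots A. cmod r = 1} = n - 2 * l"
    and ne: "\<And>l. l \<le> n div 2 \<Longrightarrow> G l \<noteq> {}"
  shows "carrier_mat n n = (\<Union>l \<in> {0..n div 2}. mat_closure n (G l))"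
    and "\<forall>l1 \<in> {0..n div 2}. \<forall>l2 \<in> {0..n div 2}. l1 \<noteq> l2 \<longrightarrow>
      mat_closure n (G l1) \<inter> G l2 = {}"
    and "\<forall>l1 \<in> {0..n div 2}. \<forall>l2 \<in> {0..n div 2}. l1 \<noteq> l2 \<longrightarrow>
      mat_closure n (G l1) \<noteq> mat_closure n (G l2)"
proof -
  obtain B where B: "ses.generic n B" using ne[of 0] G[of 0] by auto
  have all: "\<exists>l\<le>n div 2. C \<in> G l" if C: "ses.generic n C" for C
  proof -
    obtain cs rs :: "complex list" where "length cs + 2 * length rs = n"
      "length cs = card {r \<in> ses.pencil_roots C. cmod r = 1}"
      by (rule ses_normal_form[OF C]) blast
    then have "length rs \<le> n div 2" "card {r \<in> ses.pencil_roots C. cmod r = 1} = n - 2 * length rs"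
      by simp_all
    then show ?thesis using G C by blast
  qed
  have "mat_closure n (\<Union>l\<in>{0..n div 2}. G l) = carrier_mat n n"
  proof (rule mat_closure_eqI)
    fix A :: "complex mat" and e :: real assume "A \<in> carrier_mat n n" "e > 0"
    then obtain C where C: "ses.generic n C" "\<forall>i<n. \<forall>j<n. cmod (C $$ (i, j) - A $$ (i, j)) < e"
      using ses.generic_dense[OF _ B] by blast
    have "C \<in> (\<Union>l\<in>{0..n div 2}. G l)" using all[OF C(1)] by auto
    moreover have "C \<in> carrier_mat n n" using C(1) by (simp add: ses.generic_def)
    ultimately show "\<exists>C\<in>\<Union>l\<in>{0..n div 2}. G l. C \<in> carrier_mat n n \<and>
        (\<forall>i<n. \<forall>j<n. cmod (C $$ (i, j) - A $$ (i, j)) < e)"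
      using C(2) by blast
  qed
  then show "carrier_mat n n = (\<Union>l \<in> {0..n div 2}. mat_closure n (G l))"
    by (simp add: mat_closure_UN)
  have disj: "mat_closure n (G l1) \<inter> G l2 = {}"
    if l: "l1 \<le> n div 2" "l2 \<le> n div 2" "l1 \<noteq> l2" for l1 l2
  proof (rule ccontr)
    assume "mat_closure n (G l1) \<inter> G l2 \<noteq> {}"
    then obtain B where B: "B \<in> mat_closure n (G l1)" "B \<in> G l2" by blast
    obtain A where A: "\<And>k. A k \<in> G l1"
      "\<And>i j. i < n \<Longrightarrow> j < n \<Longrightarrow> (\<lambda>k. A k $$ (i, j)) \<longlonglongrightarrow> B $$ (i, j)"
      using mat_closure_sequence[OF B(1)] by metis
    have gA: "ses.generic n (A k)"
      and cA: "card {r \<in> ses.pencil_roots (A k). cmod r = 1} = n - 2 * l1" for k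
      using A(1)[of k] G[OF l(1)] by simp_all
    have gB: "ses.generic n B" and cB: "card {r \<in> ses.pencil_roots B. cmod r = 1} = n - 2 * l2"
      using B(2) G[OF l(2)] by simp_all
    have "n - 2 * l1 = n - 2 * l2"
      using card_unit_roots_limit[OF gA gB A(2)] unfolding cA cB by simp
    then show False using l by linarith
  qed
  then show "\<forall>l1 \<in> {0..n div 2}. \<forall>l2 \<in> {0..n div 2}. l1 \<noteq> l2 \<longrightarrow>
      mat_closure n (G l1) \<inter> G l2 = {}" by simp
  have sub: "G l \<subseteq> mat_closure n (G l)" if "l \<le> n div 2" for l
    unfolding mat_closure_def using G[OF that]
    by (intro closure_of_subset) (auto simp: topspace_mat_topology ses.generic_def)
  show "\<forall>l1 \<in> {0..n div 2}. \<forall>l2 \<in> {0..n div 2}. l1 \<noteq> l2 \<longrightarrow>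
      mat_closure n (G l1) \<noteq> mat_closure n (G l2)"
  proof (intro ballI impI notI)
    fix l1 l2 assume l: "l1 \<in> {0..n div 2}" "l2 \<in> {0..n div 2}" "l1 \<noteq> l2"
      and e: "mat_closure n (G l1) = mat_closure n (G l2)"
    \<comment> \<open>Equal closures would make \<open>G l2\<close> disjoint from its own closure,
      although it is nonempty and contained in it.\<close>
    then have "mat_closure n (G l2) \<inter> G l2 = {}" using disj[of l1 l2] by simp
    then show False using sub[of l2] ne[of l2] l by auto
  qed
qed

theorem theorem4p1:

  fixes n :: nat
  assumes "n \<ge> 1"
  shows "(\<forall>\<mu> :: nat \<Rightarrow> complex.
            (\<forall>i \<in> {1..n div 2}. cmod (\<mu> i) > 1 \<or>
               (\<exists>\<theta>::real. 0 < \<theta> \<and> \<theta> < pi \<and> \<mu> i = exp (\<i> * of_real \<theta>))) \<and>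
            (\<forall>i \<in> {1..n div 2}. \<forall>i' \<in> {1..n div 2}. i \<noteq> i' \<longrightarrow> \<mu> i \<noteq> \<mu> i')
            \<longrightarrow> carrier_mat n n = mat_closure n (generic_congruence_bundle n \<mu>))
       \<and>
         (\<forall>(\<mu> :: nat \<Rightarrow> nat \<Rightarrow> complex) (\<alpha> :: nat \<Rightarrow> nat \<Rightarrow> complex) (G :: nat \<Rightarrow> complex mat set).
            (\<forall>l \<in> {0..n div 2}.
               (\<forall>i \<in> {1..l}. cmod (\<mu> l i) > 1) \<and>
               (\<forall>i \<in> {1..l}. \<forall>i' \<in> {1..l}. i \<noteq> i' \<longrightarrow> \<mu> l i \<noteq> \<mu> l i') \<and>
               (\<forall>j \<in> {1..n - 2 * l}. cmod (\<alpha> l j) = 1) \<and>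
               (\<forall>j \<in> {1..n - 2 * l}. \<forall>j' \<in> {1..n - 2 * l}.
                  j \<noteq> j' \<longrightarrow> (\<alpha> l j)\<^sup>2 \<noteq> (\<alpha> l j')\<^sup>2) \<and>
               G l = generic_star_congruence_bundle n l (\<mu> l) (\<alpha> l))
            \<longrightarrow> carrier_mat n n = (\<Union>l \<in> {0..n div 2}. mat_closure n (G l)) \<and>
                (\<forall>l1 \<in> {0..n div 2}. \<forall>l2 \<in> {0..n div 2}. l1 \<noteq> l2 \<longrightarrow>
                   (mat_closure n (G l1)) \<inter> G l2 = {}) \<and>
                (\<forall>l1 \<in> {0..n div 2}. \<forall>l2 \<in> {0..n div 2}. l1 \<noteq> l2 \<longrightarrow>
                   mat_closure n (G l1) \<noteq> mat_closure n (G l2)))"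
proof ((rule conjI; intro allI impI), goal_cases)
  case (1 \<mu>)
  show ?case
    by (rule mat_closure_generic_congruence_bundle) (unfold typeIIa_def, fact 1[THEN conjunct1], fact 1[THEN conjunct2])
next
  case (2 \<mu> \<alpha> G)
  have *: "A \<in> G l \<longleftrightarrow> ses.generic n A \<and> card {r \<in> ses.pencil_roots A. cmod r = 1} = n - 2 * l"
    if "l \<le> n div 2" for l A
    using 2[rule_format, of l] that generic_star_congruence_bundle_iff[OF that, of "\<mu> l" "\<alpha> l" A] by auto
  have ne: "G l \<noteq> {}" if "l \<le> n div 2" for l
    using 2[rule_format, of l] that ses_generic_representative[OF that, of "\<mu> l" "\<alpha> l"] *[OF that] by auto
  show ?case by (intro conjI mat_closure_generic_star_bundles[OF * ne])
qed

end
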